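(* Let $p$ be an odd prime, let $M$ and $G$ be finite $p$-groups, and let $\mu:M\to G$ be a crossed module. If $M$ is powerful and $\mu(M)$ is powerfully embedded in $G$, then $M\otimes G$ and $M\otimes^p G$ are powerful.
   Context: For $p$ odd, a finite $p$-group $P$ is powerful if $[P,P]\leqslant P^p$, and a normal subgroup $N$ of $P$ is powerfully embedded in $P$ if $[N,P]\leqslant N^p$, where $N^p$ is the subgroup generated by $p$th powers. A crossed module is a homomorphism $\mu:M\to G$ with an action of $G$ on $M$ by automorphisms such that $\mu({}^gm)=g\mu(m)g^{-1}$ and ${}^{\mu(m)}m'=mm'm^{-1}$. Given crossed modules $\mu:M\to G$, $\nu:N\to G$, the groups $M,N$ act on $M$ and $N$ via $G$. The tensor product $M\otimes N$ is the group generated by symbols $m\otimes n$ ($m\in M,n\in N$) with relations (1) $m\otimes nn'=(m\otimes n)({}^nm\otimes{}^nn')$, (2) $mm'\otimes n=({}^mm'\otimes{}^mn)(m\otimes n)$. Let $K=M\times_GN=\{(m,n):\mu(m)=\nu(n)\}$ with projections $\pi_1,\pi_2$ to $M,N$; $K$ acts via its image in $G$. For a positive integer $q$, the tensor product modulo $q$, $M\otimes^qN$, is the group generated by symbols $m\otimes n$ and $\{k\}$ ($m\in M,n\in N,k\in K$) with relations (1), (2) and (3) $\{k\}(m\otimes n)\{k\}^{-1}={}^{k^q}m\otimes{}^{k^q}n$, (4) $\{kk'\}=\{k\}\prod_{i=1}^{q-1}\big(\pi_1k^{-1}\otimes({}^{k^{1-q+i}}\pi_2k')^i\big)\{k'\}$,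 (5) $[\{k\},\{k'\}]=\pi_1k^q\otimes\pi_2k'^q$, (6) $\{(m\,{}^nm^{-1},{}^mn\,n^{-1})\}=(m\otimes n)^q$. $M\otimes G$ and $M\otimes^pG$ are taken with $N=G$ and $\nu=\mathrm{id}_G$ (so $G$ acts on itself by conjugation and ${}^mg=\mu(m)g\mu(m)^{-1}$). Convention: $[a,b]=aba^{-1}b^{-1}$. *)

theory Defs
  imports "HOL-Algebra.Algebra"
begin

section \<open>Powerful $p$-groups\<close>

definition finite_p_group :: "nat \<Rightarrow> ('a, 'b) monoid_scheme \<Rightarrow> bool" where
  "finite_p_group p P \<longleftrightarrow> group P \<and> finite (carrier P) \<and> (\<exists>n. order P = p ^ n)"

definition power_subgroup :: "('a, 'b) monoid_scheme \<Rightarrow> 'a set \<Rightarrow> nat \<Rightarrow> 'a set" where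
  "power_subgroup P N p = generate P {x [^]\<^bsub>P\<^esub> p | x. x \<in> N}"

definition commutator_subgroup :: "('a, 'b) monoid_scheme \<Rightarrow> 'a set \<Rightarrow> 'a set \<Rightarrow> 'a set" where
  "commutator_subgroup P H K =
     generate P {h \<otimes>\<^bsub>P\<^esub> k \<otimes>\<^bsub>P\<^esub> inv\<^bsub>P\<^esub> h \<otimes>\<^bsub>P\<^esub> inv\<^bsub>P\<^esub> k | h k. h \<in> H \<and> k \<in> K}"

text \<open>
  The following two notions are the ones appropriate for an odd prime \<open>p\<close>; for \<open>p = 2\<close> fourth powers
  take the place of \<open>p\<close>th powers. Being a finite \<open>p\<close>-group is part of both of them.
\<close>

definition powerful :: "nat \<Rightarrow> ('a, 'b) monoid_scheme \<Rightarrow> bool" where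
  "powerful p P \<longleftrightarrow> finite_p_group p P \<and>
     commutator_subgroup P (carrier P) (carrier P) \<subseteq> power_subgroup P (carrier P) p"

definition powerfully_embedded :: "nat \<Rightarrow> 'a set \<Rightarrow> ('a, 'b) monoid_scheme \<Rightarrow> bool" where
  "powerfully_embedded p N P \<longleftrightarrow> finite_p_group p P \<and> N \<lhd> P \<and>
     commutator_subgroup P N (carrier P) \<subseteq> power_subgroup P N p"


section \<open>Crossed modules\<close>

locale crossed_module = M: group M + G: group G
  for M :: "('m, 'a) monoid_scheme" and G :: "('g, 'b) monoid_scheme" +
  fixes \<mu> :: "'m \<Rightarrow> 'g" and \<alpha> :: "'g \<Rightarrow> 'm \<Rightarrow> 'm"
  assumes boundary_hom: "\<mu> \<in> hom M G"
    and action_hom: "\<alpha> \<in> hom G (AutoGroup M)"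
    and equivariant: "\<lbrakk>g \<in> carrier G; m \<in> carrier M\<rbrakk> \<Longrightarrow>
      \<mu> (\<alpha> g m) = g \<otimes>\<^bsub>G\<^esub> \<mu> m \<otimes>\<^bsub>G\<^esub> inv\<^bsub>G\<^esub> g"
    and peiffer: "\<lbrakk>m \<in> carrier M; m' \<in> carrier M\<rbrakk> \<Longrightarrow>
      \<alpha> (\<mu> m) m' = m \<otimes>\<^bsub>M\<^esub> m' \<otimes>\<^bsub>M\<^esub> inv\<^bsub>M\<^esub> m"

text \<open>Elements of \<^const>\<open>AutoGroup\<close> are extensional functions, hence the bounded abstraction.\<close>

definition conj_action :: "('g, 'b) monoid_scheme \<Rightarrow> 'g \<Rightarrow> 'g \<Rightarrow> 'g" where
  "conj_action G g = (\<lambda>x\<in>carrier G. g \<otimes>\<^bsub>G\<^esub> x \<otimes>\<^bsub>G\<^esub> inv\<^bsub>G\<^esub> g)"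

definition fibre_product ::
  "('m, 'a) monoid_scheme \<Rightarrow> ('n, 'c) monoid_scheme \<Rightarrow> ('m \<Rightarrow> 'g) \<Rightarrow> ('n \<Rightarrow> 'g) \<Rightarrow> ('m \<times> 'n) monoid" where
  "fibre_product M N \<mu> \<nu> =
     (M \<times>\<times> N)\<lparr>carrier := {(m, n). m \<in> carrier M \<and> n \<in> carrier N \<and> \<mu> m = \<nu> n}\<rparr>"


section \<open>Groups given by generators and relations\<close>

text \<open>
  A letter \<open>(x, True)\<close> stands for the generator \<open>x\<close>, and \<open>(x, False)\<close> for its formal inverse.
  A relation is a pair of words, to be read as an equation. Pairs that are not words
  in the generators \<open>S\<close> are ignored, so that \<open>word_cong S R\<close> is always an equivalence relation on
  the set of words.
\<close>

type_synonym 'x word = "('x \<times> bool) list"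

definition words :: "'x set \<Rightarrow> 'x word set" where
  "words S = lists (S \<times> UNIV)"

definition word_inv :: "'x word \<Rightarrow> 'x word" where
  "word_inv w = rev (map (\<lambda>(x, b). (x, \<not> b)) w)"

definition word_pow :: "'x word \<Rightarrow> nat \<Rightarrow> 'x word" where
  "word_pow w n = concat (replicate n w)"

inductive_set word_cong :: "'x set \<Rightarrow> 'x word rel \<Rightarrow> 'x word rel"
  for S :: "'x set" and R :: "'x word rel" where
  refl: "w \<in> words S \<Longrightarrow> (w, w) \<in> word_cong S R"
| sym: "(u, v) \<in> word_cong S R \<Longrightarrow> (v, u) \<in> word_cong S R"
| trans: "\<lbrakk>(u, v) \<in> word_cong S R; (v, w) \<in> word_cong S R\<rbrakk> \<Longrightarrow> (u, w) \<in> word_cong S R"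
| append: "\<lbrakk>(u, u') \<in> word_cong S R; (v, v') \<in> word_cong S R\<rbrakk> \<Longrightarrow> (u @ v, u' @ v') \<in> word_cong S R"
| cancel: "x \<in> S \<Longrightarrow> ([(x, b), (x, \<not> b)], []) \<in> word_cong S R"
| rel: "\<lbrakk>(u, v) \<in> R; u \<in> words S; v \<in> words S\<rbrakk> \<Longrightarrow> (u, v) \<in> word_cong S R"

definition presented_group :: "'x set \<Rightarrow> 'x word rel \<Rightarrow> 'x word set monoid" where
  "presented_group S R =
     \<lparr>carrier = words S // word_cong S R,
      monoid.mult = (\<lambda>A B. word_cong S R `` {u @ v | u v. u \<in> A \<and> v \<in> B}),
      monoid.one = word_cong S R `` {[]}\<rparr>"


section \<open>Nonabelian tensor products\<close>

datatype ('m, 'n) tensor_gen = Tens 'm 'n | Brace "'m \<times> 'n"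

abbreviation tens :: "'m \<Rightarrow> 'n \<Rightarrow> ('m, 'n) tensor_gen word" where
  "tens m n \<equiv> [(Tens m n, True)]"

abbreviation brace :: "'m \<times> 'n \<Rightarrow> ('m, 'n) tensor_gen word" where
  "brace k \<equiv> [(Brace k, True)]"

text \<open>
  Throughout, \<open>(M, G, \<mu>, \<alpha>)\<close> and \<open>(N, G, \<nu>, \<beta>)\<close> are crossed modules over the same group \<open>G\<close>, which
  occurs only through \<open>\<mu>\<close>, \<open>\<nu>\<close>, \<open>\<alpha>\<close> and \<open>\<beta>\<close>.
\<close>

definition tensor_rels ::
  "('m, 'a) monoid_scheme \<Rightarrow> ('m \<Rightarrow> 'g) \<Rightarrow> ('g \<Rightarrow> 'm \<Rightarrow> 'm) \<Rightarrow>
   ('n, 'c) monoid_scheme \<Rightarrow> ('n \<Rightarrow> 'g) \<Rightarrow> ('g \<Rightarrow> 'n \<Rightarrow> 'n) \<Rightarrow> ('m, 'n) tensor_gen word rel" where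
  "tensor_rels M \<mu> \<alpha> N \<nu> \<beta> =
     {(tens m (n \<otimes>\<^bsub>N\<^esub> n'), tens m n @ tens (\<alpha> (\<nu> n) m) (\<beta> (\<nu> n) n')) | m n n'.
        m \<in> carrier M \<and> n \<in> carrier N \<and> n' \<in> carrier N} \<union>
     {(tens (m \<otimes>\<^bsub>M\<^esub> m') n, tens (\<alpha> (\<mu> m) m') (\<beta> (\<mu> m) n) @ tens m n) | m m' n.
        m \<in> carrier M \<and> m' \<in> carrier M \<and> n \<in> carrier N}"

definition tensor_product ::
  "('m, 'a) monoid_scheme \<Rightarrow> ('m \<Rightarrow> 'g) \<Rightarrow> ('g \<Rightarrow> 'm \<Rightarrow> 'm) \<Rightarrow>
   ('n, 'c) monoid_scheme \<Rightarrow> ('n \<Rightarrow> 'g) \<Rightarrow> ('g \<Rightarrow> 'n \<Rightarrow> 'n) \<Rightarrow> ('m, 'n) tensor_gen word set monoid" where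
  "tensor_product M \<mu> \<alpha> N \<nu> \<beta> =
     presented_group {Tens m n | m n. m \<in> carrier M \<and> n \<in> carrier N} (tensor_rels M \<mu> \<alpha> N \<nu> \<beta>)"

text \<open>
  An element \<open>k\<close> of the fibre product acts on \<open>M\<close> and \<open>N\<close> through \<open>\<mu> (fst k) = \<nu> (snd k)\<close>. The four
  sets below, meant for positive \<open>q\<close>, contain, in this order: the action of \<open>{k}\<close> on \<open>m \<otimes> n\<close>, the expansion of \<open>{k k'}\<close>
  (a product over \<open>i = 1, \<dots>, q - 1\<close>, in increasing order, involving the possibly negative powers
  \<open>1 - q + i\<close> of \<open>k\<close>), the commutator of \<open>{k}\<close> and \<open>{k'}\<close>, and the value of the brace
  on \<open>(m \<^sup>nm\<inverse>, \<^sup>mn n\<inverse>)\<close>.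
\<close>

definition tensor_mod_rels ::
  "nat \<Rightarrow> ('m, 'a) monoid_scheme \<Rightarrow> ('m \<Rightarrow> 'g) \<Rightarrow> ('g \<Rightarrow> 'm \<Rightarrow> 'm) \<Rightarrow>
   ('n, 'c) monoid_scheme \<Rightarrow> ('n \<Rightarrow> 'g) \<Rightarrow> ('g \<Rightarrow> 'n \<Rightarrow> 'n) \<Rightarrow> ('m, 'n) tensor_gen word rel" where
  "tensor_mod_rels q M \<mu> \<alpha> N \<nu> \<beta> =
     (let K = fibre_product M N \<mu> \<nu> in
     {(brace k @ tens m n @ word_inv (brace k),
       tens (\<alpha> (\<mu> (fst (k [^]\<^bsub>K\<^esub> q))) m) (\<beta> (\<mu> (fst (k [^]\<^bsub>K\<^esub> q))) n)) | k m n.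
        k \<in> carrier K \<and> m \<in> carrier M \<and> n \<in> carrier N} \<union>
     {(brace (k \<otimes>\<^bsub>K\<^esub> k'),
       brace k @
       concat (map (\<lambda>i. tens (fst (inv\<^bsub>K\<^esub> k))
                 (\<beta> (\<mu> (fst (k [^]\<^bsub>K\<^esub> (1 - int q + int i)))) (snd k') [^]\<^bsub>N\<^esub> i)) [1..<q]) @
       brace k') | k k'.
        k \<in> carrier K \<and> k' \<in> carrier K} \<union>
     {(brace k @ brace k' @ word_inv (brace k) @ word_inv (brace k'),
       tens (fst (k [^]\<^bsub>K\<^esub> q)) (snd (k' [^]\<^bsub>K\<^esub> q))) | k k'.
        k \<in> carrier K \<and> k' \<in> carrier K} \<union>
     {(brace (m \<otimes>\<^bsub>M\<^esub> \<alpha> (\<nu> n) (inv\<^bsub>M\<^esub> m), \<beta> (\<mu> m) n \<otimes>\<^bsub>N\<^esub> inv\<^bsub>N\<^esub> n), word_pow (tens m n) q) | m n.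
        m \<in> carrier M \<and> n \<in> carrier N})"

definition tensor_product_mod ::
  "nat \<Rightarrow> ('m, 'a) monoid_scheme \<Rightarrow> ('m \<Rightarrow> 'g) \<Rightarrow> ('g \<Rightarrow> 'm \<Rightarrow> 'm) \<Rightarrow>
   ('n, 'c) monoid_scheme \<Rightarrow> ('n \<Rightarrow> 'g) \<Rightarrow> ('g \<Rightarrow> 'n \<Rightarrow> 'n) \<Rightarrow> ('m, 'n) tensor_gen word set monoid" where
  "tensor_product_mod q M \<mu> \<alpha> N \<nu> \<beta> =
     presented_group
       ({Tens m n | m n. m \<in> carrier M \<and> n \<in> carrier N} \<union>
        {Brace k | k. k \<in> carrier (fibre_product M N \<mu> \<nu>)})
       (tensor_rels M \<mu> \<alpha> N \<nu> \<beta> \<union> tensor_mod_rels q M \<mu> \<alpha> N \<nu> \<beta>)"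

end

theory Submission
  imports Defs
begin

text \<open>
  Let \<open>T = M \<otimes> G\<close>, with the boundary \<open>\<lambda> : T \<rightarrow> M\<close>, \<open>\<lambda> (m \<otimes> g) = m \<^sup>gm\<inverse>\<close>, and the diagonal action of \<open>G\<close>.
  Two identities control everything: conjugation by \<open>t\<close> is the action of \<open>\<mu> (\<lambda> t)\<close>, and
  \<open>\<lambda> t \<otimes> g = t (\<^sup>gt)\<inverse>\<close>. In particular \<open>ker \<lambda>\<close> is central and \<open>[t, u] = \<lambda> t \<otimes> \<mu> (\<lambda> u)\<close>.

  \<open>T\<close> is a finite \<open>p\<close>-group: averaging the two tensor relations shows that the image of every
  \<open>m \<otimes> g\<close> in an abelian group has order dividing \<open>|G||M|\<close>. Applied to the transfer
  \<open>T \<rightarrow> ker \<lambda>\<close> this bounds the exponent of \<open>T\<close> by a power of \<open>p\<close>, and as \<open>T\<close> is generated by the finite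
  conjugation-invariant set of all \<open>m \<otimes> g\<close>, Dietzmann's lemma makes it finite.

  \<open>T\<close> is powerful: the commutators lie in \<open>M \<otimes> \<mu>(M)\<^sup>p\<close>. Consider \<open>M \<otimes> \<mu>(M)\<^sup>p\<close> together with
  \<open>M\<^sup>p \<otimes> \<mu>(M)\<close>, modulo an invariant subgroup \<open>H \<supseteq> T\<^sup>p\<close> for which \<open>G\<close> fixes these elements modulo
  \<open>H\<close>. Then \<open>m \<otimes> n\<^sup>p\<close> is the product of the \<open>d\<^sup>i (m \<otimes> n)\<close> for \<open>0 \<le> i < p\<close> with \<open>d\<close> central, so it is
  trivial because \<open>p\<close> is odd; the same works for \<open>m\<^sup>p \<otimes> n\<close>. As the \<open>p\<close>-group \<open>G\<close> acts nilpotently on \<open>T\<close>, these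
  elements lie in \<open>T\<^sup>p\<close>.

  In \<open>M \<otimes>\<^sup>p G\<close> the image of \<open>T\<close> is normal with quotient an image of \<open>M\<close>, and all commutators
  of generators are images of elements of \<open>T\<^sup>p\<close>.
\<close>

section \<open>Finite $p$-groups and Dietzmann's lemma\<close>

text \<open>A prime \<open>q\<close> dividing the part of the order prime to \<open>p\<close> would,
  by Sylow, give a subgroup of order \<open>q\<close>. The order of a nontrivial element of it
  divides both \<open>q\<close> and \<open>p ^ k\<close>, which are coprime.\<close>

lemma (in group) finite_p_group_if_exponent:
  assumes fin: "finite (carrier G)" and p: "Factorial_Ring.prime (p::nat)"
    and exp: "\<And>x. x \<in> carrier G \<Longrightarrow> x [^] (p ^ k) = \<one>"
  shows "finite_p_group p G"
proof -
  have pos: "order G \<noteq> 0"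
    using fin by (simp add: order_gt_0_iff_finite)
  obtain m where m: "order G = p ^ multiplicity p (order G) * m" "\<not> p dvd m"
    using multiplicity_decompose'[of "order G" p] pos p
    by (metis not_prime_unit mult.commute)
  have "m = 1"
  proof (rule ccontr)
    assume "m \<noteq> 1"
    then obtain q where q: "Factorial_Ring.prime q" "q dvd m"
      using prime_factor_nat by blast
    then have "q dvd order G"
      using m(1) by (metis dvd_mult)
    then obtain r where r: "order G = q ^ 1 * r"
      by auto
    obtain H where H: "subgroup H G" "card H = q"
      using sylow_thm[OF q(1) is_group r fin] by auto
    have "card H > 1"
      using H(2) q(1) prime_gt_1_nat by simp
    then have "\<not> H \<subseteq> {\<one>}"
      using card_mono[of "{\<one>}" H] by auto
    then obtain x where x: "x \<in> H" "x \<noteq> \<one>"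
      by blast
    have xG: "x \<in> carrier G"
      using H(1) x(1) by (rule subgroup.mem_carrier)
    have "x [^]\<^bsub>G\<lparr>carrier := H\<rparr>\<^esub> order (G\<lparr>carrier := H\<rparr>) = \<one>\<^bsub>G\<lparr>carrier := H\<rparr>\<^esub>"
      using group.pow_order_eq_1[OF subgroup.subgroup_is_group[OF H(1) is_group]] x(1) by simp
    then have "x [^] q = \<one>"
      using H(2) by (simp add: order_def flip: nat_pow_consistent)
    moreover have "coprime q (p ^ k)"
      using q m(2) p by (metis coprime_power_right_iff primes_coprime)
    ultimately have "ord x dvd 1"
      using exp[OF xG] pow_eq_id[OF xG] coprime_common_divisor[of q "p ^ k" "ord x"] by simp
    then have "ord x = 1"
      by simp
    then show False
      using x(2) xG ord_eq_1 by blast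
  qed
  then show ?thesis
    unfolding finite_p_group_def using m(1) fin is_group by (metis mult.right_neutral)
qed

lemma (in group) foldr_closed:
  "set xs \<subseteq> carrier G \<Longrightarrow> foldr (\<otimes>) xs \<one> \<in> carrier G"
  by (induction xs) auto

lemma (in group) foldr_append_eq:
  "set xs \<subseteq> carrier G \<Longrightarrow> set ys \<subseteq> carrier G \<Longrightarrow>
     foldr (\<otimes>) (xs @ ys) \<one> = foldr (\<otimes>) xs \<one> \<otimes> foldr (\<otimes>) ys \<one>"
  by (induction xs) (auto simp: foldr_closed m_assoc simp del: foldr_append)

lemma (in group) inv_mult_cancel [simp]:
  assumes "x \<in> carrier G" "y \<in> carrier G"
  shows "inv x \<otimes> (x \<otimes> y) = y" "x \<otimes> (inv x \<otimes> y) = y"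
  using assms by (simp_all flip: m_assoc)

lemma (in group) foldr_conj:
  assumes "x \<in> carrier G" "set ys \<subseteq> carrier G"
  shows "foldr (\<otimes>) (map (\<lambda>y. inv x \<otimes> y \<otimes> x) ys) \<one> = inv x \<otimes> foldr (\<otimes>) ys \<one> \<otimes> x"
  using assms(2) by (induction ys) (auto simp: assms foldr_closed m_assoc)

text \<open>Moving a letter to the front of a word only conjugates the letters it passes, and it does
  not change the number of later occurrences of that letter.\<close>

lemma (in group) extract_power:
  assumes A: "A \<subseteq> carrier G" "x \<in> A"
    and conj: "\<And>y. y \<in> A \<Longrightarrow> inv x \<otimes> y \<otimes> x \<in> A"
    and "set w \<subseteq> A" "n \<le> count_list w x"
  shows "\<exists>w'. set w' \<subseteq> A \<and> length w = length w' + n \<and>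
           foldr (\<otimes>) w \<one> = x [^] n \<otimes> foldr (\<otimes>) w' \<one>"
  using assms(4,5)
proof (induction n arbitrary: w)
  case 0
  then have "foldr (\<otimes>) w \<one> \<in> carrier G"
    using A by (intro foldr_closed) auto
  then show ?case
    using 0 by (intro exI[of _ w]) auto
next
  case (Suc n)
  have xG: "x \<in> carrier G"
    using A by auto
  have "x \<in> set w"
    using Suc.prems(2) by (metis count_list_0_iff not_less_eq_eq zero_le)
  then obtain u v where w: "w = u @ x # v" "x \<notin> set u"
    by (meson split_list_first)
  let ?u = "map (\<lambda>y. inv x \<otimes> y \<otimes> x) u"
  have uv: "set u \<subseteq> carrier G" "set v \<subseteq> carrier G" "set (?u @ v) \<subseteq> A"
    using Suc.prems(1) w conj A by auto
  have u': "set ?u \<subseteq> carrier G"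
    using uv xG by auto
  have "foldr (\<otimes>) w \<one> = foldr (\<otimes>) u \<one> \<otimes> (x \<otimes> foldr (\<otimes>) v \<one>)"
    using foldr_append_eq[of u "x # v"] uv xG w(1) by simp
  also have "\<dots> = x \<otimes> (foldr (\<otimes>) ?u \<one> \<otimes> foldr (\<otimes>) v \<one>)"
    using uv xG by (simp add: foldr_conj foldr_closed m_assoc)
  also have "foldr (\<otimes>) ?u \<one> \<otimes> foldr (\<otimes>) v \<one> = foldr (\<otimes>) (?u @ v) \<one>"
    using foldr_append_eq[OF u' uv(2)] by simp
  finally have prod: "foldr (\<otimes>) w \<one> = x \<otimes> foldr (\<otimes>) (?u @ v) \<one>" .
  \<comment> \<open>The split is at the first \<open>x\<close>, so \<open>u\<close> contains none
    and the remaining occurrences all lie in \<open>v\<close>.\<close>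
  have "n \<le> count_list (?u @ v) x"
    using Suc.prems(2) w by (simp add: count_list_0_iff[THEN iffD2])
  from Suc.IH[OF uv(3) this] obtain w'
    where w': "set w' \<subseteq> A" "length (?u @ v) = length w' + n"
      "foldr (\<otimes>) (?u @ v) \<one> = x [^] n \<otimes> foldr (\<otimes>) w' \<one>"
    by blast
  have "foldr (\<otimes>) w' \<one> \<in> carrier G"
    using w'(1) A by (intro foldr_closed) auto
  then have "foldr (\<otimes>) w \<one> = x [^] Suc n \<otimes> foldr (\<otimes>) w' \<one>"
    using prod w'(3) xG nat_pow_Suc2[OF xG, of n] by (simp add: m_assoc)
  then show ?case
    using w' w by (intro exI[of _ w']) auto
qed

text \<open>By pigeonhole a word longer than \<open>card A * e\<close> contains some letter at least
  \<open>e\<close> times. Collecting \<open>e\<close> copies in front produces a trivial power, so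
  the word can be shortened, and words of bounded length give all elements.\<close>

lemma (in group) dietzmann:
  assumes A: "finite A" "A \<subseteq> carrier G" "generate G A = carrier G"
    and conj: "\<And>x y. x \<in> A \<Longrightarrow> y \<in> A \<Longrightarrow> inv x \<otimes> y \<otimes> x \<in> A"
    and e: "e > 0" "\<And>x. x \<in> A \<Longrightarrow> x [^] (e::nat) = \<one>"
  shows "finite (carrier G)"
proof -
  have short: "\<exists>w'. set w' \<subseteq> A \<and> length w' \<le> card A * e \<and> foldr (\<otimes>) w \<one> = foldr (\<otimes>) w' \<one>"
    if "set w \<subseteq> A" for w
    using that
  proof (induction "length w" arbitrary: w rule: less_induct)
    case less
    show ?case
    proof (cases "length w \<le> card A * e")
      case True
      with less show ?thesis by blast
    next
      case False
      have "\<exists>x\<in>A. e \<le> count_list w x"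
      proof (rule ccontr)
        assume "\<not> ?thesis"
        then have "count_list w x \<le> e" if "x \<in> A" for x
          using that by force
        then have "sum (count_list w) A \<le> card A * e"
          using sum_bounded_above[of A "count_list w" e] by simp
        moreover have "sum (count_list w) A = length w"
          using less.prems A(1) by (rule sum_count_set)
        ultimately show False
          using False by simp
      qed
      then obtain x where x: "x \<in> A" "e \<le> count_list w x"
        by blast
      obtain w' where w': "set w' \<subseteq> A" "length w = length w' + e"
        "foldr (\<otimes>) w \<one> = x [^] e \<otimes> foldr (\<otimes>) w' \<one>"
        using extract_power[OF A(2) x(1) conj[OF x(1)] less.prems x(2)] by blast
      have "foldr (\<otimes>) w' \<one> \<in> carrier G"
        using w'(1) A by (intro foldr_closed) auto
      then have "foldr (\<otimes>) w \<one> = foldr (\<otimes>) w' \<one>"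
        using w'(3) e(2)[OF x(1)] by simp
      then show ?thesis
        using less.hyps[of w'] w' e(1) by auto
    qed
  qed
  \<comment> \<open>The finite order of the generators turns inverses into nonnegative powers, so
    words without inverse letters suffice.\<close>
  have word: "\<exists>w. set w \<subseteq> A \<and> y = foldr (\<otimes>) w \<one>" if "y \<in> generate G A" for y
    using that
  proof (induction rule: generate.induct)
    case one
    show ?case by (rule exI[of _ "[]"]) simp
  next
    case (incl h)
    then show ?case using A by (intro exI[of _ "[h]"]) auto
  next
    case (inv h)
    have hG: "h \<in> carrier G" using inv A by auto
    have "h [^] (e - 1) \<otimes> h = \<one>"
      using e inv by (metis Suc_diff_1 nat_pow_Suc)
    then have "inv h = h [^] (e - 1)"
      using hG by (simp add: inv_equality)
    moreover have "h \<otimes> h [^] n = h [^] n \<otimes> h" for n :: nat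
      using nat_pow_Suc2[OF hG, of n] by simp
    then have "foldr (\<otimes>) (replicate n h) \<one> = h [^] n" for n :: nat
      by (induction n) simp_all
    ultimately show ?case
      using inv by (intro exI[of _ "replicate (e - 1) h"]) auto
  next
    case (eng h1 h2)
    then obtain w1 w2 where "set w1 \<subseteq> A" "h1 = foldr (\<otimes>) w1 \<one>" "set w2 \<subseteq> A" "h2 = foldr (\<otimes>) w2 \<one>"
      by blast
    then show ?case
      using A foldr_append_eq[of w1 w2] by (intro exI[of _ "w1 @ w2"]) auto
  qed
  have "y \<in> (\<lambda>w. foldr (\<otimes>) w \<one>) ` {w. set w \<subseteq> A \<and> length w \<le> card A * e}"
    if y: "y \<in> carrier G" for y
  proof -
    obtain w where w: "set w \<subseteq> A" "y = foldr (\<otimes>) w \<one>"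
      using word y A(3) by blast
    obtain w' where w': "set w' \<subseteq> A" "length w' \<le> card A * e" "foldr (\<otimes>) w \<one> = foldr (\<otimes>) w' \<one>"
      using short[OF w(1)] by blast
    show ?thesis
      unfolding w(2) w'(3) using w'(1,2) by (intro imageI) simp
  qed
  then have "carrier G \<subseteq> (\<lambda>w. foldr (\<otimes>) w \<one>) ` {w. set w \<subseteq> A \<and> length w \<le> card A * e}"
    by blast
  then show ?thesis
    using finite_lists_length_le[OF A(1), of "card A * e"] by (meson finite_subset finite_imageI)
qed

section \<open>Actions of finite p-groups\<close>

text \<open>Orbit sizes divide the order of \<open>G\<close>, so they are powers of
  \<open>p\<close>. If \<open>x0\<close> were the only fixed point, every other orbit would have
  size divisible by \<open>p\<close>, and \<open>card E\<close> would be 1 modulo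
  \<open>p\<close>.\<close>

lemma (in group_action) p_group_second_fixed_point:
  assumes p: "Factorial_Ring.prime (p::nat)" and G: "finite_p_group p G"
    and E: "finite E" "p dvd card E"
    and x0: "x0 \<in> E" "\<And>g. g \<in> carrier G \<Longrightarrow> \<phi> g x0 = x0"
  shows "\<exists>x\<in>E. x \<noteq> x0 \<and> (\<forall>g\<in>carrier G. \<phi> g x = x)"
proof (rule ccontr)
  assume no: "\<not> ?thesis"
  obtain n where n: "order G = p ^ n"
    using G by (auto simp: finite_p_group_def)
  have one: "\<one> \<in> carrier G"
    using G by (simp add: finite_p_group_def group.is_monoid)
  have orb0: "orbit G \<phi> x0 = {x0}"
    using x0 one by (force simp: orbit_def)
  have orb0_in: "{x0} \<in> orbits G E \<phi>"
    using x0(1) orb0 by (auto simp: orbits_def intro!: exI[of _ x0])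
  have fin: "finite (orbits G E \<phi>)"
    using E(1) by (simp add: orbits_def)
  have "p dvd card O'" if O': "O' \<in> orbits G E \<phi> - {{x0}}" for O'
  proof -
    obtain x where x: "x \<in> E" "O' = orbit G \<phi> x"
      using O' by (auto simp: orbits_def)
    have "card O' dvd p ^ n"
      using orbit_stabilizer_theorem[OF x(1)] n x(2) by (metis dvd_triv_left)
    then obtain i where i: "card O' = p ^ i"
      using p by (metis divides_primepow_nat)
    have "x \<noteq> x0"
      using O' x orb0 by auto
    then obtain g where g: "g \<in> carrier G" "\<phi> g x \<noteq> x"
      using no x(1) by blast
    have sub: "{x, \<phi> g x} \<subseteq> O'"
      using orbit_refl[OF x(1)] g x(2) by (auto simp: orbit_def)
    have "O' \<subseteq> E"
      using x element_image by (auto simp: orbit_def)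
    then have "card {x, \<phi> g x} \<le> card O'"
      using sub E(1) by (meson card_mono finite_subset)
    then have "i \<noteq> 0"
      using i g(2) by (intro notI) auto
    then show ?thesis
      using i by simp
  qed
  then have "p dvd (\<Sum>O'\<in>orbits G E \<phi> - {{x0}}. card O')"
    by (rule dvd_sum)
  moreover have "card E = (\<Sum>O'\<in>orbits G E \<phi>. card O')"
    using disjoint_sum[OF E(1), of "\<lambda>_. 1 :: nat"] by simp
  then have "card E = 1 + (\<Sum>O'\<in>orbits G E \<phi> - {{x0}}. card O')"
    using sum.remove[OF fin orb0_in, of card] by simp
  ultimately have "p dvd 1"
    using E(2) by (metis dvd_add_left_iff)
  then show False
    using p not_prime_unit by blast
qed

text \<open>\<open>G\<close> permutes the cosets of \<open>Z\<close>. Their number is a nontrivial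
  power of \<open>p\<close> and the coset \<open>Z\<close> is fixed, so another coset is fixed as
  well; its representatives are fixed modulo \<open>Z\<close> without lying in
  \<open>Z\<close>.\<close>

lemma nilpotent_action:
  fixes G (structure) and T (structure)
  assumes p: "Factorial_Ring.prime (p::nat)" and G: "finite_p_group p G" and T: "finite_p_group p T"
    and act_hom: "\<And>g. g \<in> carrier G \<Longrightarrow> act g \<in> hom T T"
    and act_mult: "\<And>g h x. g \<in> carrier G \<Longrightarrow> h \<in> carrier G \<Longrightarrow> x \<in> carrier T \<Longrightarrow>
      act (g \<otimes>\<^bsub>G\<^esub> h) x = act g (act h x)"
    and act_one: "\<And>x. x \<in> carrier T \<Longrightarrow> act \<one>\<^bsub>G\<^esub> x = x"
    and Z: "Z \<lhd> T" "Z \<noteq> carrier T" "\<And>g z. g \<in> carrier G \<Longrightarrow> z \<in> Z \<Longrightarrow> act g z \<in> Z"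
  shows "\<exists>x\<in>carrier T - Z. \<forall>g\<in>carrier G. act g x \<otimes>\<^bsub>T\<^esub> inv\<^bsub>T\<^esub> x \<in> Z"
proof -
  interpret G: group G using G by (simp add: finite_p_group_def)
  interpret T: group T using T by (simp add: finite_p_group_def)
  interpret Z: normal Z T by (rule Z(1))
  define E where "E = rcosets\<^bsub>T\<^esub> Z"
  \<comment> \<open>Restricted to \<open>E\<close>, as elements of \<open>BijGroup E\<close> are
    extensional functions.\<close>
  define \<phi> where "\<phi> g = (\<lambda>C\<in>E. act g ` C)" for g
  have closed: "act g x \<in> carrier T" if "g \<in> carrier G" "x \<in> carrier T" for g x
    using act_hom[OF that(1)] that(2) by (rule hom_in_carrier)
  have hom: "act g (x \<otimes>\<^bsub>T\<^esub> y) = act g x \<otimes>\<^bsub>T\<^esub> act g y"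
    if "g \<in> carrier G" "x \<in> carrier T" "y \<in> carrier T" for g x y
    using act_hom[OF that(1)] that(2,3) by (rule hom_mult)
  have inverse: "act g (act (inv\<^bsub>G\<^esub> g) x) = x" if "g \<in> carrier G" "x \<in> carrier T" for g x
    using that act_mult[of g "inv\<^bsub>G\<^esub> g" x] act_one by simp
  have image: "act g ` (Z #>\<^bsub>T\<^esub> x) = Z #>\<^bsub>T\<^esub> act g x" if "g \<in> carrier G" "x \<in> carrier T" for g x
  proof
    show "act g ` (Z #>\<^bsub>T\<^esub> x) \<subseteq> Z #>\<^bsub>T\<^esub> act g x"
      using that Z(3) hom Z.subset by (fastforce simp: r_coset_def)
    show "Z #>\<^bsub>T\<^esub> act g x \<subseteq> act g ` (Z #>\<^bsub>T\<^esub> x)"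
    proof
      fix y assume "y \<in> Z #>\<^bsub>T\<^esub> act g x"
      then obtain z where z: "z \<in> Z" "y = z \<otimes>\<^bsub>T\<^esub> act g x"
        by (auto simp: r_coset_def)
      then have "y = act g (act (inv\<^bsub>G\<^esub> g) z \<otimes>\<^bsub>T\<^esub> x)"
        using that hom closed inverse Z.subset by (simp add: subset_iff)
      then show "y \<in> act g ` (Z #>\<^bsub>T\<^esub> x)"
        using z(1) Z(3)[of "inv\<^bsub>G\<^esub> g" z] that(1) by (auto simp: r_coset_def)
    qed
  qed
  have E: "\<exists>x\<in>carrier T. C = Z #>\<^bsub>T\<^esub> x" if "C \<in> E" for C
    using that by (auto simp: E_def RCOSETS_def)
  have E_I: "Z #>\<^bsub>T\<^esub> x \<in> E" if "x \<in> carrier T" for x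
    using that by (auto simp: E_def RCOSETS_def)
  have phi: "\<phi> g (Z #>\<^bsub>T\<^esub> x) = Z #>\<^bsub>T\<^esub> act g x" if "g \<in> carrier G" "x \<in> carrier T" for g x
    using that image E_I by (simp add: \<phi>_def)
  have phi_E: "\<phi> g C \<in> E" if "g \<in> carrier G" "C \<in> E" for g C
  proof -
    obtain x where "x \<in> carrier T" "C = Z #>\<^bsub>T\<^esub> x"
      using E[OF \<open>C \<in> E\<close>] by blast
    then show ?thesis
      using that(1) phi closed E_I by simp
  qed
  have phi_mult: "\<phi> (g \<otimes>\<^bsub>G\<^esub> h) C = \<phi> g (\<phi> h C)" if "g \<in> carrier G" "h \<in> carrier G" "C \<in> E" for g h C
  proof -
    obtain x where "x \<in> carrier T" "C = Z #>\<^bsub>T\<^esub> x"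
      using E[OF \<open>C \<in> E\<close>] by blast
    then show ?thesis
      using that(1,2) phi closed act_mult by simp
  qed
  have phi_one: "\<phi> \<one>\<^bsub>G\<^esub> C = C" if "C \<in> E" for C
  proof -
    obtain x where "x \<in> carrier T" "C = Z #>\<^bsub>T\<^esub> x"
      using E[OF \<open>C \<in> E\<close>] by blast
    then show ?thesis
      using phi act_one by simp
  qed
  have phi_Bij: "\<phi> g \<in> Bij E" if "g \<in> carrier G" for g
  proof -
    have "bij_betw (\<phi> g) E E"
      using that phi_E phi_one phi_mult[of "inv\<^bsub>G\<^esub> g" g] phi_mult[of g "inv\<^bsub>G\<^esub> g"]
      by (intro bij_betwI[where g = "\<phi> (inv\<^bsub>G\<^esub> g)"]) auto
    then show ?thesis
      by (simp add: Bij_def \<phi>_def)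
  qed
  have "\<phi> (g \<otimes>\<^bsub>G\<^esub> h) = compose E (\<phi> g) (\<phi> h)" if "g \<in> carrier G" "h \<in> carrier G" for g h
  proof (rule extensionalityI[of _ E])
    show "\<phi> (g \<otimes>\<^bsub>G\<^esub> h) \<in> extensional E"
      by (simp add: \<phi>_def)
    show "\<phi> (g \<otimes>\<^bsub>G\<^esub> h) C = compose E (\<phi> g) (\<phi> h) C" if "C \<in> E" for C
      using phi_mult[OF \<open>g \<in> carrier G\<close> \<open>h \<in> carrier G\<close> that] that by (simp add: compose_eq)
  qed (rule compose_extensional)
  then have "\<phi> \<in> hom G (BijGroup E)"
    by (intro homI) (simp_all add: BijGroup_def phi_Bij)
  then interpret group_action G E \<phi>
    by (intro group_action.intro group_hom.intro group_hom_axioms.intro group_BijGroup G.is_group)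
  have fin: "finite (carrier T)"
    using T by (simp add: finite_p_group_def)
  obtain n where "card E * card Z = p ^ n"
    using T.lagrange[OF Z.subgroup_axioms] T by (auto simp: E_def finite_p_group_def)
  then obtain i where i: "card E = p ^ i"
    using p by (metis divides_primepow_nat dvd_triv_left)
  have finE: "finite E"
    using fin by (simp add: E_def RCOSETS_def)
  \<comment> \<open>A single coset would make \<open>Z\<close> all of \<open>T\<close>.\<close>
  have "i \<noteq> 0"
  proof
    assume "i = 0"
    then have "card E * card Z = card Z"
      using i by simp
    then have "card Z = card (carrier T)"
      using T.lagrange[OF Z.subgroup_axioms] by (simp add: E_def order_def)
    then show False
      using card_subset_eq[OF fin Z.subset] Z(2) by simp
  qed
  then have "p dvd card E"
    using i by simp
  have Z1: "Z #>\<^bsub>T\<^esub> \<one>\<^bsub>T\<^esub> = Z"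
    by (simp add: Z.subset)
  have "act g \<one>\<^bsub>T\<^esub> = \<one>\<^bsub>T\<^esub>" if "g \<in> carrier G" for g
    using act_hom[OF that] hom_one T.is_group by blast
  then have fixes_Z: "\<phi> g Z = Z" if "g \<in> carrier G" for g
    using phi[OF that, of "\<one>\<^bsub>T\<^esub>"] that Z1 by simp
  have "Z \<in> E"
    using E_I[of "\<one>\<^bsub>T\<^esub>"] Z1 by simp
  from p_group_second_fixed_point[OF p G finE \<open>p dvd card E\<close> this fixes_Z]
  obtain C where C: "C \<in> E" "C \<noteq> Z" "\<forall>g\<in>carrier G. \<phi> g C = C"
    by blast
  obtain x where x: "x \<in> carrier T" "C = Z #>\<^bsub>T\<^esub> x"
    using E[OF C(1)] by blast
  have "x \<notin> Z"
    using C(2) x Z.rcos_const T.is_group by blast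
  moreover have "act g x \<otimes>\<^bsub>T\<^esub> inv\<^bsub>T\<^esub> x \<in> Z" if "g \<in> carrier G" for g
  proof -
    have "Z #>\<^bsub>T\<^esub> act g x = Z #>\<^bsub>T\<^esub> x"
      using C(3) x phi that by simp
    then have "act g x \<in> Z #>\<^bsub>T\<^esub> x"
      using T.rcos_self[OF closed[OF that x(1)] Z.subgroup_axioms] by simp
    then obtain z where "z \<in> Z" "act g x = z \<otimes>\<^bsub>T\<^esub> x"
      by (auto simp: r_coset_def)
    then show ?thesis
      using x(1) Z.subset by (auto simp: T.m_assoc)
  qed
  ultimately show ?thesis
    using x(1) by blast
qed

section \<open>Transfer and commutators\<close>

text \<open>The transfer to the central kernel, formed with a section \<open>s\<close> of
  \<open>h\<close>. On a kernel element \<open>z\<close> every factor \<open>c z x\<close> equals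
  \<open>z\<close>, which gives the stated power.\<close>

lemma (in group_hom) central_transfer:
  assumes fin: "finite (h ` carrier G)"
    and central: "\<And>z x. z \<in> kernel G H h \<Longrightarrow> x \<in> carrier G \<Longrightarrow> z \<otimes>\<^bsub>G\<^esub> x = x \<otimes>\<^bsub>G\<^esub> z"
  shows "comm_group (G\<lparr>carrier := kernel G H h\<rparr>)"
    and "\<exists>V\<in>hom G (G\<lparr>carrier := kernel G H h\<rparr>). \<forall>z\<in>kernel G H h. V z = z [^]\<^bsub>G\<^esub> card (h ` carrier G)"
proof -
  define Z where "Z = kernel G H h"
  define A where "A = G\<lparr>carrier := Z\<rparr>"
  define I where "I = h ` carrier G"
  define s where "s x = (SOME t. t \<in> carrier G \<and> h t = x)" for x
  \<comment> \<open>\<open>c\<close> measures how far \<open>s\<close> is from respecting left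
    translation by \<open>t\<close>. Its values lie in the kernel, and it satisfies the cocycle rule
    \<open>c (t u) x = c t (h u x) c u x\<close>, which makes the product \<open>V\<close>
    multiplicative.\<close>
  define c where "c t x = inv\<^bsub>G\<^esub> s (h t \<otimes>\<^bsub>H\<^esub> x) \<otimes>\<^bsub>G\<^esub> (t \<otimes>\<^bsub>G\<^esub> s x)" for t x
  have Z: "subgroup Z G"
    unfolding Z_def by (rule subgroup_kernel)
  have ZG: "z \<in> carrier G" if "z \<in> Z" for z
    using that Z by (rule subgroup.mem_carrier[rotated])
  have "group A"
    unfolding A_def by (rule subgroup.subgroup_is_group[OF Z G.is_group])
  then show comm: "comm_group (G\<lparr>carrier := kernel G H h\<rparr>)"
    unfolding A_def Z_def[symmetric] using central ZG
    by (intro group.group_comm_groupI) (simp_all add: Z_def)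
  interpret A: comm_group A
    using comm by (simp add: A_def Z_def)
  have A_simps: "carrier A = Z" "x \<otimes>\<^bsub>A\<^esub> y = x \<otimes>\<^bsub>G\<^esub> y" for x y
    by (simp_all add: A_def)
  have s: "s x \<in> carrier G \<and> h (s x) = x" if "x \<in> I" for x
    using that unfolding s_def I_def by (intro someI_ex[of "\<lambda>t. t \<in> carrier G \<and> h t = x"]) auto
  have I: "x \<in> carrier H" if "x \<in> I" for x
    using that by (auto simp: I_def)
  have mult_I: "h t \<otimes>\<^bsub>H\<^esub> x \<in> I" if "t \<in> carrier G" "x \<in> I" for t x
  proof -
    obtain u where "u \<in> carrier G" "x = h u"
      using \<open>x \<in> I\<close> by (auto simp: I_def)
    then have "h t \<otimes>\<^bsub>H\<^esub> x = h (t \<otimes>\<^bsub>G\<^esub> u)" "t \<otimes>\<^bsub>G\<^esub> u \<in> carrier G"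
      using that(1) by simp_all
    then show ?thesis
      unfolding I_def by blast
  qed
  have c_Z: "c t x \<in> Z" if "t \<in> carrier G" "x \<in> I" for t x
    using that s I mult_I[OF that] by (simp add: c_def Z_def kernel_def H.m_assoc)
  have c_fun: "c t \<in> I \<rightarrow> carrier A" if "t \<in> carrier G" for t
    using that c_Z by (simp add: A_simps)
  define V where "V t = finprod A (c t) I" for t
  have "V \<in> hom G A"
  proof (rule homI)
    fix t assume t: "t \<in> carrier G"
    show "V t \<in> carrier A"
      unfolding V_def by (rule A.finprod_closed[OF c_fun[OF t]])
  next
    fix t u assume t: "t \<in> carrier G" and u: "u \<in> carrier G"
    have inj: "inj_on (\<lambda>x. h u \<otimes>\<^bsub>H\<^esub> x) I"
      using I u by (intro inj_onI) (metis H.l_cancel hom_closed)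
    have sub: "(\<lambda>x. h u \<otimes>\<^bsub>H\<^esub> x) ` I \<subseteq> I"
      using mult_I[OF u] by blast
    \<comment> \<open>Translation by \<open>h u\<close> permutes \<open>I\<close>, so the first
      factors of the cocycle rule multiply to \<open>V t\<close>.\<close>
    have image: "(\<lambda>x. h u \<otimes>\<^bsub>H\<^esub> x) ` I = I"
      using endo_inj_surj[OF _ sub inj] fin by (simp add: I_def)
    have "c (t \<otimes>\<^bsub>G\<^esub> u) x = c t (h u \<otimes>\<^bsub>H\<^esub> x) \<otimes>\<^bsub>A\<^esub> c u x" if "x \<in> I" for x
      using t u that I s mult_I[OF u that] mult_I[OF t mult_I[OF u that]]
      by (simp add: c_def A_simps H.m_assoc G.m_assoc)
    then have "V (t \<otimes>\<^bsub>G\<^esub> u) = finprod A (\<lambda>x. c t (h u \<otimes>\<^bsub>H\<^esub> x) \<otimes>\<^bsub>A\<^esub> c u x) I"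
      unfolding V_def using c_Z t u mult_I[OF u]
      by (intro A.finprod_cong') (auto simp: A_simps subgroup.m_closed[OF Z])
    also have "\<dots> = finprod A (\<lambda>x. c t (h u \<otimes>\<^bsub>H\<^esub> x)) I \<otimes>\<^bsub>A\<^esub> finprod A (c u) I"
      using c_fun[OF u] c_fun[OF t] mult_I[OF u] by (intro A.finprod_multf) auto
    also have "finprod A (\<lambda>x. c t (h u \<otimes>\<^bsub>H\<^esub> x)) I = V t"
      using A.finprod_reindex[of "c t" "\<lambda>x. h u \<otimes>\<^bsub>H\<^esub> x" I] inj c_fun[OF t] by (simp add: V_def image)
    finally show "V (t \<otimes>\<^bsub>G\<^esub> u) = V t \<otimes>\<^bsub>A\<^esub> V u"
      by (simp add: V_def)
  qed
  moreover have "V z = z [^]\<^bsub>G\<^esub> card I" if z: "z \<in> Z" for z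
  proof -
    have hz: "h z = \<one>\<^bsub>H\<^esub>"
      using z by (simp add: Z_def kernel_def)
    have "c z x = z" if "x \<in> I" for x
      using hz s[OF that] I[OF that] z ZG central[of z "s x"] by (simp add: c_def Z_def)
    then have "V z = finprod A (\<lambda>_. z) I"
      unfolding V_def using z by (intro A.finprod_cong') (auto simp: A_simps)
    also have "\<dots> = z [^]\<^bsub>A\<^esub> card I"
      using z by (intro A.finprod_const) (simp add: A_simps)
    also have "\<dots> = z [^]\<^bsub>G\<^esub> card I"
      by (simp add: A_def flip: G.nat_pow_consistent)
    finally show ?thesis .
  qed
  ultimately show "\<exists>V\<in>hom G (G\<lparr>carrier := kernel G H h\<rparr>).
      \<forall>z\<in>kernel G H h. V z = z [^]\<^bsub>G\<^esub> card (h ` carrier G)"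
    unfolding A_def Z_def I_def by blast
qed

section \<open>Commuting generators and twisted powers\<close>

text \<open>Centralizers are subgroups, which is applied twice: first the centralizer of
  \<open>S\<close> is everything, then the centre contains \<open>S\<close> and hence
  everything.\<close>

lemma (in group) commutes_if_generators_commute:
  assumes "S \<subseteq> carrier G" "generate G S = carrier G"
    and "\<And>x y. x \<in> S \<Longrightarrow> y \<in> S \<Longrightarrow> x \<otimes> y = y \<otimes> x"
    and "x \<in> carrier G" "y \<in> carrier G"
  shows "x \<otimes> y = y \<otimes> x"
proof -
  have centralizer: "subgroup {x \<in> carrier G. \<forall>y\<in>C. x \<otimes> y = y \<otimes> x} G" if C: "C \<subseteq> carrier G" for C
  proof (rule subgroupI)
    fix a b assume ab: "a \<in> {x \<in> carrier G. \<forall>y\<in>C. x \<otimes> y = y \<otimes> x}" "b \<in> {x \<in> carrier G. \<forall>y\<in>C. x \<otimes> y = y \<otimes> x}"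
    have "a \<otimes> b \<otimes> y = y \<otimes> (a \<otimes> b)" if "y \<in> C" for y
    proof -
      have y: "y \<in> carrier G" "a \<otimes> y = y \<otimes> a" "b \<otimes> y = y \<otimes> b"
        using that C ab by auto
      have "a \<otimes> b \<otimes> y = a \<otimes> (b \<otimes> y)"
        using ab y(1) by (simp add: m_assoc)
      also have "\<dots> = (a \<otimes> y) \<otimes> b"
        using ab y(1) by (simp add: y(3) m_assoc)
      also have "\<dots> = y \<otimes> (a \<otimes> b)"
        using ab y(1) by (simp add: y(2) m_assoc)
      finally show ?thesis .
    qed
    then show "a \<otimes> b \<in> {x \<in> carrier G. \<forall>y\<in>C. x \<otimes> y = y \<otimes> x}"
      using ab by simp
  next
    fix a assume a: "a \<in> {x \<in> carrier G. \<forall>y\<in>C. x \<otimes> y = y \<otimes> x}"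
    have "inv a \<otimes> y = y \<otimes> inv a" if "y \<in> C" for y
    proof -
      have y: "y \<in> carrier G" "a \<in> carrier G" "a \<otimes> y = y \<otimes> a"
        using that C a by auto
      have "inv a \<otimes> y = inv a \<otimes> (y \<otimes> a) \<otimes> inv a"
        using y(1,2) by (simp add: m_assoc)
      also have "\<dots> = y \<otimes> inv a"
        using y(1,2) by (simp flip: y(3))
      finally show ?thesis .
    qed
    then show "inv a \<in> {x \<in> carrier G. \<forall>y\<in>C. x \<otimes> y = y \<otimes> x}"
      using a by simp
  qed (use C in \<open>auto intro!: exI[of _ \<one>]\<close>)
  have "carrier G \<subseteq> {x \<in> carrier G. \<forall>y\<in>S. x \<otimes> y = y \<otimes> x}"
    using generate_subgroup_incl[OF _ centralizer[OF assms(1)], of S] assms by auto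
  then have "carrier G \<subseteq> {x \<in> carrier G. \<forall>y\<in>carrier G. x \<otimes> y = y \<otimes> x}"
    using generate_subgroup_incl[OF _ centralizer[OF subset_refl], of S] assms by force
  then show ?thesis
    using assms(4,5) by blast
qed

text \<open>The exponent \<open>0 + 1 + \<dots> + (p - 1)\<close> of \<open>c\<close> is a multiple of the odd number \<open>p\<close>.\<close>

lemma (in group) twisted_power_trivial:
  assumes p: "odd (p::nat)" and exp: "\<And>x. x \<in> carrier G \<Longrightarrow> x [^] p = \<one>"
    and ac: "a \<in> carrier G" "c \<in> carrier G" "c \<otimes> a = a \<otimes> c"
    and f: "f 0 = \<one>" "\<And>j. f (Suc j) = f j \<otimes> (c [^] j \<otimes> a)"
  shows "f p = \<one>"
proof -
  have comm: "c [^] (i::nat) \<otimes> a [^] (j::nat) = a [^] j \<otimes> c [^] i" for i j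
  proof -
    have "c \<otimes> a [^] j = a [^] j \<otimes> c" for j :: nat
    proof (induction j)
      case (Suc j)
      have "c \<otimes> a [^] Suc j = (c \<otimes> a [^] j) \<otimes> a"
        using ac by (simp add: m_assoc)
      also have "\<dots> = a [^] j \<otimes> (c \<otimes> a)"
        using ac by (simp add: Suc m_assoc)
      also have "\<dots> = a [^] Suc j \<otimes> c"
        using ac by (simp add: m_assoc)
      finally show ?case .
    qed (use ac in simp)
    note 1 = this
    show ?thesis
    proof (induction i)
      case (Suc i)
      have "c [^] Suc i \<otimes> a [^] j = c [^] i \<otimes> (c \<otimes> a [^] j)"
        using ac by (simp add: m_assoc)
      also have "\<dots> = (c [^] i \<otimes> a [^] j) \<otimes> c"
        using ac by (simp add: 1 m_assoc)
      also have "\<dots> = a [^] j \<otimes> c [^] Suc i"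
        using ac by (simp add: Suc m_assoc)
      finally show ?case .
    qed (use ac in simp)
  qed
  \<comment> \<open>Collecting the commuting powers leaves the exponent
    \<open>0 + 1 + ... + (j - 1)\<close> on \<open>c\<close>.\<close>
  have "f j = c [^] (\<Sum>i<j. i) \<otimes> a [^] j" for j
  proof (induction j)
    case (Suc j)
    have "f (Suc j) = c [^] (\<Sum>i<j. i) \<otimes> (a [^] j \<otimes> c [^] j) \<otimes> a"
      using ac by (simp add: f Suc m_assoc)
    also have "a [^] j \<otimes> c [^] j = c [^] j \<otimes> a [^] j"
      by (rule comm[symmetric])
    also have "c [^] (\<Sum>i<j. i) \<otimes> (c [^] j \<otimes> a [^] j) \<otimes> a = (c [^] (\<Sum>i<j. i) \<otimes> c [^] j) \<otimes> a [^] Suc j"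
      using ac by (simp add: m_assoc)
    also have "c [^] (\<Sum>i<j. i) \<otimes> c [^] j = c [^] (\<Sum>i<Suc j. i)"
      using ac by (simp add: nat_pow_mult)
    finally show ?case .
  qed (use f in simp)
  moreover have "(\<Sum>i<p. i) = p * ((p - 1) div 2)"
  proof -
    have "(\<Sum>i<p. i) = p * (p - 1) div 2"
      by (metis Sum_Ico_nat atLeast0LessThan diff_zero mult_0 diff_0_eq_0)
    then show ?thesis
      using p by (simp add: div_mult_swap)
  qed
  ultimately show ?thesis
    using exp ac by (simp flip: nat_pow_pow)
qed

section \<open>Crossed modules and their tensor products\<close>

lemma (in group) hom_eq_on_generators:
  assumes H: "group H" and S: "S \<subseteq> carrier G" "generate G S = carrier G"
    and f: "f \<in> hom G H" and k: "k \<in> hom G H"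
    and eq: "\<And>x. x \<in> S \<Longrightarrow> f x = k x"
    and x: "x \<in> carrier G"
  shows "f x = k x"
proof -
  interpret f: group_hom G H f
    by (intro group_hom.intro group_hom_axioms.intro is_group H f)
  interpret k: group_hom G H k
    by (intro group_hom.intro group_hom_axioms.intro is_group H k)
  have "x \<in> generate G S"
    using S x by simp
  then show ?thesis
  proof (induction rule: generate.induct)
    case (inv h)
    then show ?case
      using eq S by (metis f.hom_inv k.hom_inv subsetD)
  next
    case (eng h1 h2)
    then show ?case
      using S by simp
  qed (use eq in auto)
qed

section \<open>Elementary rules for the action in a crossed module\<close>

context crossed_module
begin

sublocale boundary: group_hom M G \<mu>
  by (intro group_hom.intro group_hom_axioms.intro M.is_group G.is_group boundary_hom)

lemma action_group_hom: "g \<in> carrier G \<Longrightarrow> group_hom M M (\<alpha> g)"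
  using hom_in_carrier[OF action_hom, of g]
  by (intro group_hom.intro group_hom_axioms.intro M.is_group) (simp add: AutoGroup_def auto_def)

lemma action_closed [simp]: "g \<in> carrier G \<Longrightarrow> m \<in> carrier M \<Longrightarrow> \<alpha> g m \<in> carrier M"
  by (rule group_hom.hom_closed[OF action_group_hom])

lemma action_mult:
  "g \<in> carrier G \<Longrightarrow> m \<in> carrier M \<Longrightarrow> m' \<in> carrier M \<Longrightarrow> \<alpha> g (m \<otimes>\<^bsub>M\<^esub> m') = \<alpha> g m \<otimes>\<^bsub>M\<^esub> \<alpha> g m'"
  by (rule group_hom.hom_mult[OF action_group_hom])

lemma action_inv:
  "g \<in> carrier G \<Longrightarrow> m \<in> carrier M \<Longrightarrow> \<alpha> g (inv\<^bsub>M\<^esub> m) = inv\<^bsub>M\<^esub> \<alpha> g m"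
  by (rule group_hom.hom_inv[OF action_group_hom])

lemma action_comp:
  assumes "g \<in> carrier G" "h \<in> carrier G" "m \<in> carrier M"
  shows "\<alpha> (g \<otimes>\<^bsub>G\<^esub> h) m = \<alpha> g (\<alpha> h m)"
proof -
  have "\<alpha> g \<in> Bij (carrier M)" "\<alpha> h \<in> Bij (carrier M)"
    using hom_in_carrier[OF action_hom] assms by (auto simp: AutoGroup_def auto_def)
  then show ?thesis
    using hom_mult[OF action_hom assms(1,2)] assms(3)
    by (simp add: AutoGroup_def BijGroup_def compose_eq)
qed

lemma action_one: "m \<in> carrier M \<Longrightarrow> \<alpha> \<one>\<^bsub>G\<^esub> m = m"
  using hom_one[OF action_hom G.is_group M.AutoGroup] by (simp add: AutoGroup_def BijGroup_def)

end

abbreviation (in crossed_module) conjugate :: "'g \<Rightarrow> 'g \<Rightarrow> 'g"  where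
  "conjugate g h \<equiv> g \<otimes>\<^bsub>G\<^esub> h \<otimes>\<^bsub>G\<^esub> inv\<^bsub>G\<^esub> g"

section \<open>The tensor product described by its structure maps\<close>

text \<open>Records what the argument needs of the tensor product, so that no words occur in it. The
  universal property enters here only through the homomorphisms \<open>lam\<close> and
  \<open>act\<close>, supplied for the presented group by
  \<open>crossed_tensor_exists\<close>.\<close>

locale crossed_tensor = crossed_module M G \<mu> \<alpha> + T: group T
  for M :: "('m, 'a) monoid_scheme" and G :: "('g, 'b) monoid_scheme"
    and \<mu> :: "'m \<Rightarrow> 'g" and \<alpha> :: "'g \<Rightarrow> 'm \<Rightarrow> 'm" and T :: "('t, 'c) monoid_scheme" (structure) +
  fixes \<tau> :: "'m \<Rightarrow> 'g \<Rightarrow> 't" and lam :: "'t \<Rightarrow> 'm" and act :: "'g \<Rightarrow> 't \<Rightarrow> 't"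
  assumes tensor_closed [simp]: "\<lbrakk>m \<in> carrier M; g \<in> carrier G\<rbrakk> \<Longrightarrow> \<tau> m g \<in> carrier T"
    and tensor_generates: "generate T {\<tau> m g | m g. m \<in> carrier M \<and> g \<in> carrier G} = carrier T"
    and lam_hom: "lam \<in> hom T M"
    and lam_tensor: "\<lbrakk>m \<in> carrier M; g \<in> carrier G\<rbrakk> \<Longrightarrow> lam (\<tau> m g) = m \<otimes>\<^bsub>M\<^esub> \<alpha> g (inv\<^bsub>M\<^esub> m)"
    and act_hom: "g \<in> carrier G \<Longrightarrow> act g \<in> hom T T"
    and act_tensor: "\<lbrakk>g \<in> carrier G; m \<in> carrier M; h \<in> carrier G\<rbrakk> \<Longrightarrow>
      act g (\<tau> m h) = \<tau> (\<alpha> g m) (conjugate g h)"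
    and tensor_mult_right: "\<lbrakk>m \<in> carrier M; g \<in> carrier G; h \<in> carrier G\<rbrakk> \<Longrightarrow>
      \<tau> m (g \<otimes>\<^bsub>G\<^esub> h) = \<tau> m g \<otimes> act g (\<tau> m h)"
    and tensor_mult_left: "\<lbrakk>m \<in> carrier M; m' \<in> carrier M; g \<in> carrier G\<rbrakk> \<Longrightarrow>
      \<tau> (m \<otimes>\<^bsub>M\<^esub> m') g = act (\<mu> m) (\<tau> m' g) \<otimes> \<tau> m g"
begin

sublocale lam: group_hom T M lam
  by (intro group_hom.intro group_hom_axioms.intro T.is_group M.is_group lam_hom)

lemma act_group_hom: "g \<in> carrier G \<Longrightarrow> group_hom T T (act g)"
  by (intro group_hom.intro group_hom_axioms.intro T.is_group act_hom)

lemma act_closed [simp]: "g \<in> carrier G \<Longrightarrow> t \<in> carrier T \<Longrightarrow> act g t \<in> carrier T"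
  by (rule group_hom.hom_closed[OF act_group_hom])

lemma act_mult [simp]:
  "g \<in> carrier G \<Longrightarrow> t \<in> carrier T \<Longrightarrow> u \<in> carrier T \<Longrightarrow> act g (t \<otimes> u) = act g t \<otimes> act g u"
  by (rule group_hom.hom_mult[OF act_group_hom])

lemma act_inv [simp]: "g \<in> carrier G \<Longrightarrow> t \<in> carrier T \<Longrightarrow> act g (inv t) = inv act g t"
  by (rule group_hom.hom_inv[OF act_group_hom])

lemma act_unit [simp]: "g \<in> carrier G \<Longrightarrow> act g \<one> = \<one>"
  by (rule group_hom.hom_one[OF act_group_hom])

lemma tensors_closed: "{\<tau> m g | m g. m \<in> carrier M \<and> g \<in> carrier G} \<subseteq> carrier T"
  by auto

text \<open>Each single \<open>act g\<close> is a homomorphism by assumption, so the law for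
  products can be checked on generators, where it is that of \<open>\<alpha>\<close> and of
  conjugation.\<close>

lemma act_comp:
  assumes "g \<in> carrier G" "h \<in> carrier G" "t \<in> carrier T"
  shows "act (g \<otimes>\<^bsub>G\<^esub> h) t = act g (act h t)"
proof (rule T.hom_eq_on_generators[OF T.is_group tensors_closed tensor_generates _ _ _ assms(3)])
  show "act (g \<otimes>\<^bsub>G\<^esub> h) \<in> hom T T"
    using assms by (simp add: act_hom)
  show "(\<lambda>t. act g (act h t)) \<in> hom T T"
    using assms by (intro homI) auto
qed (use assms in \<open>auto simp: act_tensor action_comp G.m_assoc G.inv_mult_group\<close>)

lemma act_one:
  assumes "t \<in> carrier T"
  shows "act \<one>\<^bsub>G\<^esub> t = t"
proof (rule T.hom_eq_on_generators[OF T.is_group tensors_closed tensor_generates _ _ _ assms])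
  show "(\<lambda>t. t) \<in> hom T T"
    by (intro homI) auto
qed (auto simp: act_tensor action_one act_hom)

lemma act_inverse [simp]:
  assumes "g \<in> carrier G" "t \<in> carrier T"
  shows "act g (act (inv\<^bsub>G\<^esub> g) t) = t" "act (inv\<^bsub>G\<^esub> g) (act g t) = t"
  using assms by (simp_all add: act_one flip: act_comp)

lemma tensor_induct [consumes 1, case_names one tensor inv mult]:
  assumes "t \<in> carrier T" and "P \<one>"
    and "\<And>m g. m \<in> carrier M \<Longrightarrow> g \<in> carrier G \<Longrightarrow> P (\<tau> m g)"
    and "\<And>t. t \<in> carrier T \<Longrightarrow> P t \<Longrightarrow> P (inv t)"
    and "\<And>t u. t \<in> carrier T \<Longrightarrow> u \<in> carrier T \<Longrightarrow> P t \<Longrightarrow> P u \<Longrightarrow> P (t \<otimes> u)"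
  shows "P t"
proof -
  have "t \<in> generate T {\<tau> m g | m g. m \<in> carrier M \<and> g \<in> carrier G}"
    using assms(1) tensor_generates by simp
  then have "t \<in> carrier T \<and> P t"
    by (induction rule: generate.induct) (use assms in auto)
  then show ?thesis ..
qed

text \<open>Expand \<open>m m' \<otimes> g g'\<close> in two ways.\<close>

lemma tensor_conj:
  assumes "m \<in> carrier M" "g \<in> carrier G" "u \<in> carrier T"
  shows "act (\<mu> m \<otimes>\<^bsub>G\<^esub> g) u = \<tau> m g \<otimes> act (g \<otimes>\<^bsub>G\<^esub> \<mu> m) u \<otimes> inv \<tau> m g"
proof (rule T.hom_eq_on_generators[OF T.is_group tensors_closed tensor_generates _ _ _ assms(3)])
  let ?t = "\<tau> m g"
  show "(\<lambda>u. ?t \<otimes> act (g \<otimes>\<^bsub>G\<^esub> \<mu> m) u \<otimes> inv ?t) \<in> hom T T"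
    using assms by (intro homI) (auto simp: T.m_assoc)
  show "act (\<mu> m \<otimes>\<^bsub>G\<^esub> g) \<in> hom T T"
    using assms by (simp add: act_hom)
  fix u assume "u \<in> {\<tau> m g | m g. m \<in> carrier M \<and> g \<in> carrier G}"
  then obtain m' g' where u: "u = \<tau> m' g'" "m' \<in> carrier M" "g' \<in> carrier G"
    by blast
  have uT: "u \<in> carrier T"
    using u by simp
  let ?a = "act (\<mu> m) (\<tau> m' g)" and ?b = "act g (\<tau> m g')"
  \<comment> \<open>The left relation is applied first here and the right relation first in the next
    equation; cancelling the outer factors \<open>?a\<close> and \<open>?b\<close> compares the
    rest.\<close>
  have "\<tau> (m \<otimes>\<^bsub>M\<^esub> m') (g \<otimes>\<^bsub>G\<^esub> g') = ?a \<otimes> (act (\<mu> m \<otimes>\<^bsub>G\<^esub> g) u \<otimes> ?t \<otimes> ?b)"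
    using assms u tensor_mult_left[of m m' "g \<otimes>\<^bsub>G\<^esub> g'"]
    by (simp add: tensor_mult_right act_comp T.m_assoc)
  moreover have "\<tau> (m \<otimes>\<^bsub>M\<^esub> m') (g \<otimes>\<^bsub>G\<^esub> g') = ?a \<otimes> (?t \<otimes> act (g \<otimes>\<^bsub>G\<^esub> \<mu> m) u \<otimes> ?b)"
    using assms u tensor_mult_right[of "m \<otimes>\<^bsub>M\<^esub> m'" g g']
    by (simp add: tensor_mult_left act_comp T.m_assoc)
  ultimately have "act (\<mu> m \<otimes>\<^bsub>G\<^esub> g) u \<otimes> ?t \<otimes> ?b = ?t \<otimes> act (g \<otimes>\<^bsub>G\<^esub> \<mu> m) u \<otimes> ?b"
    using assms u uT by simp
  then have "act (\<mu> m \<otimes>\<^bsub>G\<^esub> g) u \<otimes> ?t = ?t \<otimes> act (g \<otimes>\<^bsub>G\<^esub> \<mu> m) u"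
    using assms u uT by simp
  then show "act (\<mu> m \<otimes>\<^bsub>G\<^esub> g) u = ?t \<otimes> act (g \<otimes>\<^bsub>G\<^esub> \<mu> m) u \<otimes> inv ?t"
    using assms uT by (simp add: T.inv_solve_right)
qed

text \<open>For a generator, \<open>\<mu> (lam (\<tau> m g))\<close> is the commutator of
  \<open>\<mu> m\<close> and \<open>g\<close>, so the claim is \<open>tensor_conj\<close> at the
  shifted argument \<open>?v\<close>. Both sides are compatible with products and inverses in
  \<open>t\<close>.\<close>

lemma conj_eq_act:
  assumes "t \<in> carrier T" "u \<in> carrier T"
  shows "t \<otimes> u \<otimes> inv t = act (\<mu> (lam t)) u"
  using assms
proof (induction t arbitrary: u rule: tensor_induct)
  case one
  then show ?case by (simp add: act_one)
next
  case (tensor m g)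
  let ?v = "act (inv\<^bsub>G\<^esub> (g \<otimes>\<^bsub>G\<^esub> \<mu> m)) u"
  have "\<mu> (lam (\<tau> m g)) = \<mu> m \<otimes>\<^bsub>G\<^esub> g \<otimes>\<^bsub>G\<^esub> inv\<^bsub>G\<^esub> (g \<otimes>\<^bsub>G\<^esub> \<mu> m)"
    using tensor by (simp add: lam_tensor equivariant G.inv_mult_group G.m_assoc)
  then have "act (\<mu> (lam (\<tau> m g))) u = act (\<mu> m \<otimes>\<^bsub>G\<^esub> g) ?v"
    using tensor by (simp add: act_comp del: G.inv_mult_group)
  also have "\<dots> = \<tau> m g \<otimes> u \<otimes> inv \<tau> m g"
    using tensor tensor_conj[of m g ?v] act_inverse(1)[of "g \<otimes>\<^bsub>G\<^esub> \<mu> m" u] by simp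
  finally show ?case by simp
next
  case (inv t)
  have "u = t \<otimes> (inv t \<otimes> u \<otimes> t) \<otimes> inv t"
    using inv by (simp add: T.m_assoc)
  also have "\<dots> = act (\<mu> (lam t)) (inv t \<otimes> u \<otimes> t)"
    using inv by simp
  finally have "act (inv\<^bsub>G\<^esub> \<mu> (lam t)) u = act (inv\<^bsub>G\<^esub> \<mu> (lam t)) (act (\<mu> (lam t)) (inv t \<otimes> u \<otimes> t))"
    by simp
  also have "\<dots> = inv t \<otimes> u \<otimes> t"
    using inv by (intro act_inverse) auto
  finally show ?case
    using inv by simp
next
  case (mult s t)
  have "s \<otimes> t \<otimes> u \<otimes> inv (s \<otimes> t) = s \<otimes> (t \<otimes> u \<otimes> inv t) \<otimes> inv s"
    using mult.hyps mult.prems by (simp add: T.m_assoc T.inv_mult_group)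
  then show ?case
    using mult by (simp add: act_comp)
qed

lemma tensor_one_left:
  assumes "g \<in> carrier G"
  shows "\<tau> \<one>\<^bsub>M\<^esub> g = \<one>"
  using tensor_mult_left[of "\<one>\<^bsub>M\<^esub>" "\<one>\<^bsub>M\<^esub>" g] assms by (simp add: act_one)

lemma tensor_one_right:
  assumes "m \<in> carrier M"
  shows "\<tau> m \<one>\<^bsub>G\<^esub> = \<one>"
  using tensor_mult_right[of m "\<one>\<^bsub>G\<^esub>" "\<one>\<^bsub>G\<^esub>"] assms by (simp add: act_one)

lemma tensor_inv_left:
  assumes "m \<in> carrier M" "g \<in> carrier G"
  shows "act (\<mu> m) (\<tau> (inv\<^bsub>M\<^esub> m) g) = inv \<tau> m g"
  using tensor_mult_left[of m "inv\<^bsub>M\<^esub> m" g] assms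
  by (simp add: tensor_one_left T.inv_equality)

text \<open>Both sides follow the same twisted product rule in \<open>t\<close>, because conjugation
  by \<open>t\<close> is the action of \<open>\<mu> (lam t)\<close>; this reduces the claim to
  generators.\<close>

lemma tensor_lam_left:
  assumes "t \<in> carrier T" "g \<in> carrier G"
  shows "\<tau> (lam t) g = t \<otimes> inv act g t"
  using assms(1)
proof (induction t rule: tensor_induct)
  case one
  then show ?case using assms by (simp add: tensor_one_left)
next
  case (tensor m h)
  \<comment> \<open>\<open>?k\<close> is chosen so that conjugation by \<open>h\<close> carries it
    to \<open>g\<close>. Hence \<open>h ?k = g h\<close>, and the right relation can be applied to
    both factorizations.\<close>
  let ?t = "\<tau> m h" and ?k = "inv\<^bsub>G\<^esub> h \<otimes>\<^bsub>G\<^esub> g \<otimes>\<^bsub>G\<^esub> h"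
  note mem = tensor assms(2)
  have g: "conjugate h ?k = g" "h \<otimes>\<^bsub>G\<^esub> ?k = g \<otimes>\<^bsub>G\<^esub> h"
    using mem by (simp_all add: G.m_assoc)
  have "act (\<mu> m) (\<tau> (\<alpha> h (inv\<^bsub>M\<^esub> m)) g) = act (\<mu> m \<otimes>\<^bsub>G\<^esub> h) (\<tau> (inv\<^bsub>M\<^esub> m) ?k)"
    using mem act_tensor[of h "inv\<^bsub>M\<^esub> m" ?k] g(1) by (simp add: act_comp)
  also have "\<dots> = ?t \<otimes> act (h \<otimes>\<^bsub>G\<^esub> \<mu> m) (\<tau> (inv\<^bsub>M\<^esub> m) ?k) \<otimes> inv ?t"
    using mem by (intro tensor_conj) auto
  also have "act (h \<otimes>\<^bsub>G\<^esub> \<mu> m) (\<tau> (inv\<^bsub>M\<^esub> m) ?k) = inv act h (\<tau> m ?k)"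
    using mem tensor_inv_left[of m ?k] by (simp add: act_comp)
  finally have 1: "\<tau> (lam ?t) g = ?t \<otimes> inv act h (\<tau> m ?k) \<otimes> inv ?t \<otimes> \<tau> m g"
    using mem tensor_mult_left[of m "\<alpha> h (inv\<^bsub>M\<^esub> m)" g] by (simp add: lam_tensor)
  have "?t \<otimes> act h (\<tau> m ?k) = \<tau> m g \<otimes> act g ?t"
    using mem g(2) tensor_mult_right[of m h ?k] tensor_mult_right[of m g h] by simp
  then have "inv act h (\<tau> m ?k) \<otimes> inv ?t = inv act g ?t \<otimes> inv \<tau> m g"
    using mem by (simp flip: T.inv_mult_group)
  then show ?case
    using 1 mem by (simp add: T.m_assoc)
next
  case (inv t)
  \<comment> \<open>Expanding the tensor with trivial left entry \<open>lam t\<close> times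
    \<open>lam (inv t)\<close> determines the value at \<open>inv t\<close>.\<close>
  have "\<one> = \<tau> (lam t \<otimes>\<^bsub>M\<^esub> lam (inv t)) g"
    using inv assms by (simp add: tensor_one_left)
  also have "\<dots> = (t \<otimes> \<tau> (lam (inv t)) g \<otimes> inv t) \<otimes> (t \<otimes> inv act g t)"
    using inv assms tensor_mult_left[of "lam t" "lam (inv t)" g] conj_eq_act[of t "\<tau> (lam (inv t)) g"]
    by simp
  also have "\<dots> = t \<otimes> \<tau> (lam (inv t)) g \<otimes> inv act g t"
    using inv assms by (simp add: T.m_assoc)
  finally have "act g t = t \<otimes> \<tau> (lam (inv t)) g"
    using inv assms by (simp add: T.inv_solve_right)
  then show ?case
    using inv assms by (simp add: T.inv_solve_left del: lam.hom_inv)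
next
  case (mult s t)
  have "\<tau> (lam (s \<otimes> t)) g = (s \<otimes> \<tau> (lam t) g \<otimes> inv s) \<otimes> \<tau> (lam s) g"
    using mult assms tensor_mult_left[of "lam s" "lam t" g] conj_eq_act[of s "\<tau> (lam t) g"] by simp
  also have "\<dots> = (s \<otimes> t) \<otimes> inv act g (s \<otimes> t)"
    using mult assms by (simp add: T.m_assoc T.inv_mult_group)
  finally show ?case .
qed

text \<open>The commutator is \<open>t\<close> times the inverse of its conjugate by
  \<open>u\<close>, and that conjugate is the action of \<open>\<mu> (lam u)\<close> on
  \<open>t\<close>.\<close>

lemma commutator_eq_tensor:
  assumes "t \<in> carrier T" "u \<in> carrier T"
  shows "t \<otimes> u \<otimes> inv t \<otimes> inv u = \<tau> (lam t) (\<mu> (lam u))"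
  using assms conj_eq_act[of u "inv t"] tensor_lam_left[of t "\<mu> (lam u)"] by (simp add: T.m_assoc)

end

section \<open>Finiteness\<close>

lemma (in comm_monoid) finprod_bij_betw:
  assumes "bij_betw k C C" "f \<in> C \<rightarrow> carrier G"
  shows "finprod G (\<lambda>x. f (k x)) C = finprod G f C"
  using finprod_reindex[of f k C] assms by (simp add: bij_betw_def)

lemma (in group) bij_betw_left_mult:
  assumes "g \<in> carrier G"
  shows "bij_betw (\<lambda>x. g \<otimes> x) (carrier G) (carrier G)"
  using assms by (intro bij_betwI[where g = "\<lambda>x. inv g \<otimes> x"]) auto

lemma (in group) bij_betw_conj:
  assumes "g \<in> carrier G"
  shows "bij_betw (\<lambda>x. g \<otimes> x \<otimes> inv g) (carrier G) (carrier G)"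
  using assms by (intro bij_betwI[where g = "\<lambda>x. inv g \<otimes> x \<otimes> g"]) (auto simp: m_assoc)

context crossed_tensor
begin

text \<open>With \<open>S m\<close> the product of all \<open>f (m \<otimes> h)\<close>, reindexing turns the two tensor relations into
  \<open>S m = f (m \<otimes> g)\<^sup>|\<^sup>G\<^sup>| S (\<^sup>gm)\<close> and \<open>S (m m') = S (m m' m\<inverse>) S m\<close>; the product of the latter over all
  \<open>m'\<close> kills \<open>S m\<close>.\<close>

lemma hom_to_comm_group_torsion:
  assumes A: "comm_group A" and f: "f \<in> hom T A"
    and mg: "m \<in> carrier M" "g \<in> carrier G"
  shows "f (\<tau> m g) [^]\<^bsub>A\<^esub> (order G * order M) = \<one>\<^bsub>A\<^esub>"
proof -
  interpret A: comm_group A by (rule A)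
  interpret f: group_hom T A f
    by (intro group_hom.intro group_hom_axioms.intro T.is_group A.is_group f)
  define S where "S m = finprod A (\<lambda>h. f (\<tau> m h)) (carrier G)" for m
  have S_closed: "S m \<in> carrier A" if "m \<in> carrier M" for m
    unfolding S_def using that by (intro A.finprod_closed) auto
  have S_action: "S m = f (\<tau> m g) [^]\<^bsub>A\<^esub> order G \<otimes>\<^bsub>A\<^esub> S (\<alpha> g m)"
    if mg: "m \<in> carrier M" "g \<in> carrier G" for m g
  proof -
    have "S m = finprod A (\<lambda>h. f (\<tau> m (g \<otimes>\<^bsub>G\<^esub> h))) (carrier G)"
      unfolding S_def using mg
      by (intro A.finprod_bij_betw[OF G.bij_betw_left_mult, symmetric]) auto
    also have "\<dots> = finprod A (\<lambda>h. f (\<tau> m g) \<otimes>\<^bsub>A\<^esub> f (\<tau> (\<alpha> g m) (conjugate g h))) (carrier G)"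
      using mg by (intro A.finprod_cong') (auto simp: tensor_mult_right[of m g] act_tensor)
    also have "\<dots> = finprod A (\<lambda>h. f (\<tau> m g)) (carrier G) \<otimes>\<^bsub>A\<^esub>
        finprod A (\<lambda>h. f (\<tau> (\<alpha> g m) (conjugate g h))) (carrier G)"
      using mg by (intro A.finprod_multf) auto
    also have "finprod A (\<lambda>h. f (\<tau> m g)) (carrier G) = f (\<tau> m g) [^]\<^bsub>A\<^esub> order G"
      using mg by (simp add: A.finprod_const order_def)
    also have "finprod A (\<lambda>h. f (\<tau> (\<alpha> g m) (conjugate g h))) (carrier G) = S (\<alpha> g m)"
      unfolding S_def using mg by (intro A.finprod_bij_betw[OF G.bij_betw_conj]) auto
    finally show ?thesis .
  qed
  have S_mult: "S (m \<otimes>\<^bsub>M\<^esub> m') = S (m \<otimes>\<^bsub>M\<^esub> m' \<otimes>\<^bsub>M\<^esub> inv\<^bsub>M\<^esub> m) \<otimes>\<^bsub>A\<^esub> S m"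
    if mm': "m \<in> carrier M" "m' \<in> carrier M" for m m'
  proof -
    have "S (m \<otimes>\<^bsub>M\<^esub> m') =
        finprod A (\<lambda>h. f (\<tau> (m \<otimes>\<^bsub>M\<^esub> m' \<otimes>\<^bsub>M\<^esub> inv\<^bsub>M\<^esub> m) (conjugate (\<mu> m) h)) \<otimes>\<^bsub>A\<^esub> f (\<tau> m h)) (carrier G)"
      unfolding S_def using mm'
      by (intro A.finprod_cong') (auto simp: tensor_mult_left[of m m'] act_tensor peiffer)
    also have "\<dots> = finprod A (\<lambda>h. f (\<tau> (m \<otimes>\<^bsub>M\<^esub> m' \<otimes>\<^bsub>M\<^esub> inv\<^bsub>M\<^esub> m) (conjugate (\<mu> m) h))) (carrier G) \<otimes>\<^bsub>A\<^esub> S m"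
      unfolding S_def using mm' by (intro A.finprod_multf) auto
    also have "finprod A (\<lambda>h. f (\<tau> (m \<otimes>\<^bsub>M\<^esub> m' \<otimes>\<^bsub>M\<^esub> inv\<^bsub>M\<^esub> m) (conjugate (\<mu> m) h))) (carrier G) =
        S (m \<otimes>\<^bsub>M\<^esub> m' \<otimes>\<^bsub>M\<^esub> inv\<^bsub>M\<^esub> m)"
      unfolding S_def using mm'
      by (intro A.finprod_bij_betw[OF G.bij_betw_conj, of "\<mu> m" "\<lambda>h. f (\<tau> (m \<otimes>\<^bsub>M\<^esub> m' \<otimes>\<^bsub>M\<^esub> inv\<^bsub>M\<^esub> m) h)"]) auto
    finally show ?thesis .
  qed
  have S_torsion: "S m [^]\<^bsub>A\<^esub> order M = \<one>\<^bsub>A\<^esub>" if m: "m \<in> carrier M" for m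
  proof -
    let ?W = "finprod A S (carrier M)"
    have W: "?W \<in> carrier A"
      using S_closed by (intro A.finprod_closed) auto
    have "?W = finprod A (\<lambda>m'. S (m \<otimes>\<^bsub>M\<^esub> m')) (carrier M)"
      using m S_closed by (intro A.finprod_bij_betw[OF M.bij_betw_left_mult, symmetric]) auto
    also have "\<dots> = finprod A (\<lambda>m'. S (m \<otimes>\<^bsub>M\<^esub> m' \<otimes>\<^bsub>M\<^esub> inv\<^bsub>M\<^esub> m) \<otimes>\<^bsub>A\<^esub> S m) (carrier M)"
      using m S_closed by (intro A.finprod_cong') (auto simp: S_mult[OF m])
    also have "\<dots> = finprod A (\<lambda>m'. S (m \<otimes>\<^bsub>M\<^esub> m' \<otimes>\<^bsub>M\<^esub> inv\<^bsub>M\<^esub> m)) (carrier M) \<otimes>\<^bsub>A\<^esub> finprod A (\<lambda>m'. S m) (carrier M)"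
      using m S_closed by (intro A.finprod_multf) auto
    also have "finprod A (\<lambda>m'. S (m \<otimes>\<^bsub>M\<^esub> m' \<otimes>\<^bsub>M\<^esub> inv\<^bsub>M\<^esub> m)) (carrier M) = ?W"
      using m S_closed by (intro A.finprod_bij_betw[OF M.bij_betw_conj]) auto
    also have "finprod A (\<lambda>m'. S m) (carrier M) = S m [^]\<^bsub>A\<^esub> order M"
      using m S_closed by (simp add: A.finprod_const order_def)
    finally show ?thesis
      using W S_closed[OF m] by simp
  qed
  \<comment> \<open>Both values of \<open>S\<close> are killed by \<open>order M\<close>, so only
    the power of \<open>f (\<tau> m g)\<close> remains.\<close>
  have "S m [^]\<^bsub>A\<^esub> order M = (f (\<tau> m g) [^]\<^bsub>A\<^esub> order G) [^]\<^bsub>A\<^esub> order M \<otimes>\<^bsub>A\<^esub> S (\<alpha> g m) [^]\<^bsub>A\<^esub> order M"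
    using mg S_closed S_action[OF mg] by (simp add: A.nat_pow_distrib)
  then show ?thesis
    using mg S_torsion by (simp add: A.nat_pow_pow)
qed

text \<open>The exponent is bounded by three factors: \<open>order M\<close> moves \<open>t\<close>
  into the kernel of \<open>lam\<close>, the transfer raises it to the size of the image of
  \<open>lam\<close>, and \<open>N\<close> kills every value of the transfer.\<close>

lemma finite_p_group_tensor:
  assumes p: "Factorial_Ring.prime (p::nat)" and M: "finite_p_group p M" and G: "finite_p_group p G"
  shows "finite_p_group p T"
proof -
  have finM: "finite (carrier M)" and finG: "finite (carrier G)"
    using M G by (simp_all add: finite_p_group_def)
  define Z where "Z = kernel T M lam"
  define A where "A = T\<lparr>carrier := Z\<rparr>"
  \<comment> \<open>Conjugation by a kernel element is the action of the identity of
    \<open>G\<close>.\<close>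
  have central: "z \<otimes> x = x \<otimes> z" if "z \<in> Z" "x \<in> carrier T" for z x
  proof -
    have z: "z \<in> carrier T" "lam z = \<one>\<^bsub>M\<^esub>"
      using that(1) by (simp_all add: Z_def kernel_def)
    have "z \<otimes> x \<otimes> inv z = x"
      using z that(2) by (simp add: conj_eq_act act_one)
    then show ?thesis
      using z(1) that(2) by (metis T.inv_solve_right' T.m_closed)
  qed
  have fin_im: "finite (lam ` carrier T)"
    using finM lam.hom_closed by (meson finite_subset image_subsetI)
  interpret A: comm_group A
    unfolding A_def Z_def by (rule lam.central_transfer(1)[OF fin_im central[unfolded Z_def]])
  obtain V where V: "V \<in> hom T A" "\<And>z. z \<in> Z \<Longrightarrow> V z = z [^] card (lam ` carrier T)"
    unfolding A_def Z_def using lam.central_transfer(2)[OF fin_im central[unfolded Z_def]] by blast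
  define N where "N = order G * order M"
  \<comment> \<open>\<open>A\<close> is commutative, so taking \<open>N\<close>-th powers is a
    homomorphism and generators suffice.\<close>
  have V_torsion: "V t [^]\<^bsub>A\<^esub> N = \<one>\<^bsub>A\<^esub>" if "t \<in> carrier T" for t
  proof (rule T.hom_eq_on_generators[OF A.is_group tensors_closed tensor_generates _ _ _ that])
    show "(\<lambda>t. V t [^]\<^bsub>A\<^esub> N) \<in> hom T A"
      using hom_in_carrier[OF V(1)] hom_mult[OF V(1)]
      by (intro homI) (auto simp: A.nat_pow_distrib)
    show "(\<lambda>t. \<one>\<^bsub>A\<^esub>) \<in> hom T A"
      by (intro homI) auto
  qed (use hom_to_comm_group_torsion[OF A.comm_group_axioms V(1)] in \<open>auto simp: N_def\<close>)
  have exp: "t [^] (order M * (card (lam ` carrier T) * N)) = \<one>" if t: "t \<in> carrier T" for t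
  proof -
    let ?z = "t [^] order M"
    have "lam ?z = \<one>\<^bsub>M\<^esub>"
      using t by (simp add: lam.hom_nat_pow M.pow_order_eq_1)
    then have z: "?z \<in> Z"
      using t by (simp add: Z_def kernel_def)
    have "(?z [^] card (lam ` carrier T)) [^] N = \<one>"
      using V_torsion[of ?z] V(2)[OF z] t by (simp add: A_def flip: T.nat_pow_consistent)
    then show ?thesis
      using t by (simp add: T.nat_pow_pow mult.assoc)
  qed
  obtain a b where ab: "order M = p ^ a" "order G = p ^ b"
    using M G by (auto simp: finite_p_group_def)
  \<comment> \<open>The image of \<open>lam\<close> is a subgroup of \<open>M\<close>, so its size
    is again a power of \<open>p\<close>.\<close>
  have "card (lam ` carrier T) dvd p ^ a"
    using M.lagrange[OF lam.img_is_subgroup] ab(1) by (metis dvd_triv_right)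
  then obtain c where c: "card (lam ` carrier T) = p ^ c"
    using p by (metis divides_primepow_nat)
  have exp': "t [^] (p ^ (a + c + b + a)) = \<one>" if "t \<in> carrier T" for t
    using exp[OF that] by (simp add: N_def ab c power_add mult_ac)
  have "finite (carrier T)"
  proof (rule T.dietzmann[OF _ tensors_closed tensor_generates])
    have "{\<tau> m g | m g. m \<in> carrier M \<and> g \<in> carrier G} = (\<lambda>(m, g). \<tau> m g) ` (carrier M \<times> carrier G)"
      by auto
    then show "finite {\<tau> m g | m g. m \<in> carrier M \<and> g \<in> carrier G}"
      using finM finG by simp
    show "p ^ (a + c + b + a) > 0"
      using p by (simp add: prime_gt_0_nat)
  next
    fix x y
    assume x: "x \<in> {\<tau> m g | m g. m \<in> carrier M \<and> g \<in> carrier G}"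
      and "y \<in> {\<tau> m g | m g. m \<in> carrier M \<and> g \<in> carrier G}"
    then obtain m g where y: "y = \<tau> m g" "m \<in> carrier M" "g \<in> carrier G"
      by blast
    have xT: "x \<in> carrier T"
      using x tensors_closed by blast
    \<comment> \<open>Conjugation in \<open>T\<close> acts through \<open>G\<close>, and the action
      sends tensors to tensors; this is the closure that Dietzmann's lemma requires.\<close>
    let ?h = "\<mu> (lam (inv x))"
    have "inv x \<otimes> y \<otimes> x = \<tau> (\<alpha> ?h m) (conjugate ?h g)"
      using xT y conj_eq_act[of "inv x" y] act_tensor[of ?h m g] by (simp del: lam.hom_inv boundary.hom_inv)
    then show "inv x \<otimes> y \<otimes> x \<in> {\<tau> m g | m g. m \<in> carrier M \<and> g \<in> carrier G}"
      using xT y by (auto intro!: exI)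
  qed (use exp' tensors_closed in blast)
  then show ?thesis
    using T.finite_p_group_if_exponent[OF _ p exp'] by blast
qed

end

section \<open>Subgroups invariant under the action\<close>

lemma (in group) power_subgroup_is_subgroup:
  "N \<subseteq> carrier G \<Longrightarrow> subgroup (power_subgroup G N p) G"
  unfolding power_subgroup_def by (intro generate_is_subgroup) auto

lemma (in group) power_in_power_subgroup: "x \<in> N \<Longrightarrow> x [^] p \<in> power_subgroup G N p"
  unfolding power_subgroup_def by (rule generate.incl) blast

lemma (in group_hom) image_power_subgroup:
  assumes "N \<subseteq> carrier G"
  shows "h ` power_subgroup G N p = power_subgroup H (h ` N) p"
proof -
  have "h ` {x [^]\<^bsub>G\<^esub> p | x. x \<in> N} = {x [^]\<^bsub>H\<^esub> p | x. x \<in> h ` N}"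
    unfolding Setcompr_eq_image image_image using assms hom_nat_pow by (intro image_cong) auto
  moreover have "{x [^]\<^bsub>G\<^esub> p | x. x \<in> N} \<subseteq> carrier G"
    using assms by auto
  ultimately show ?thesis
    unfolding power_subgroup_def by (simp flip: generate_img)
qed

context crossed_tensor
begin

definition act_subgroup :: "'t set \<Rightarrow> bool" where
  "act_subgroup H \<longleftrightarrow> subgroup H T \<and> (\<forall>g\<in>carrier G. \<forall>h\<in>H. act g h \<in> H)"

text \<open>For an invariant subgroup \<open>H\<close>, this is the preimage of the elements of the
  quotient by \<open>H\<close> that \<open>G\<close> fixes. Iterating it gives an ascending
  series.\<close>

definition act_fixed :: "'t set \<Rightarrow> 't set" where
  "act_fixed H = {x \<in> carrier T. \<forall>g\<in>carrier G. act g x \<otimes> inv x \<in> H}"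

lemma act_subgroupD:
  assumes "act_subgroup H"
  shows "subgroup H T" and "\<And>g h. g \<in> carrier G \<Longrightarrow> h \<in> H \<Longrightarrow> act g h \<in> H"
  using assms by (auto simp: act_subgroup_def)

text \<open>Conjugation by \<open>x\<close> is the action of \<open>\<mu> (lam x)\<close>, so
  invariance includes normality.\<close>

lemma act_subgroup_normal:
  assumes H: "act_subgroup H"
  shows "H \<lhd> T"
  unfolding T.normal_inv_iff
proof (intro conjI ballI)
  show "subgroup H T"
    using H by (rule act_subgroupD)
  fix x h assume "x \<in> carrier T" "h \<in> H"
  then show "x \<otimes> h \<otimes> inv x \<in> H"
    using act_subgroupD[OF H] by (simp add: conj_eq_act subgroup.mem_carrier)
qed

lemma subset_act_fixed:
  assumes H: "act_subgroup H"
  shows "H \<subseteq> act_fixed H"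
proof
  interpret subgroup H T
    using H by (rule act_subgroupD)
  fix x assume "x \<in> H"
  then show "x \<in> act_fixed H"
    using act_subgroupD(2)[OF H] by (auto simp: act_fixed_def)
qed

lemma act_fixed_act_subgroup:
  assumes H: "act_subgroup H"
  shows "act_subgroup (act_fixed H)"
  unfolding act_subgroup_def
proof (intro conjI ballI)
  interpret normal H T
    using H by (rule act_subgroup_normal)
  show "subgroup (act_fixed H) T"
  proof (rule T.subgroupI)
    show "act_fixed H \<noteq> {}"
      using subset_act_fixed[OF H] one_closed by blast
  next
    fix x assume x: "x \<in> act_fixed H"
    then have xT: "x \<in> carrier T"
      by (simp add: act_fixed_def)
    have "act g (inv x) \<otimes> inv (inv x) \<in> H" if g: "g \<in> carrier G" for g
    proof -
      have "inv x \<otimes> inv (act g x \<otimes> inv x) \<otimes> x \<in> H"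
        using x g by (intro inv_op_closed1) (auto simp: act_fixed_def)
      also have "inv x \<otimes> inv (act g x \<otimes> inv x) \<otimes> x = act g (inv x) \<otimes> inv (inv x)"
        using xT g by (simp add: T.inv_mult_group T.m_assoc)
      finally show ?thesis .
    qed
    then show "inv x \<in> act_fixed H"
      using xT by (simp add: act_fixed_def)
  next
    fix x y assume x: "x \<in> act_fixed H" and y: "y \<in> act_fixed H"
    then have T: "x \<in> carrier T" "y \<in> carrier T"
      by (simp_all add: act_fixed_def)
    have "act g (x \<otimes> y) \<otimes> inv (x \<otimes> y) \<in> H" if g: "g \<in> carrier G" for g
    proof -
      \<comment> \<open>Normality allows the second defect to be conjugated by \<open>x\<close>,
        after which the product telescopes.\<close>
      have "act g x \<otimes> inv x \<in> H" "x \<otimes> (act g y \<otimes> inv y) \<otimes> inv x \<in> H"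
        using x y g by (auto simp: act_fixed_def intro: inv_op_closed2)
      then have "(act g x \<otimes> inv x) \<otimes> (x \<otimes> (act g y \<otimes> inv y) \<otimes> inv x) \<in> H"
        by (rule m_closed)
      also have "(act g x \<otimes> inv x) \<otimes> (x \<otimes> (act g y \<otimes> inv y) \<otimes> inv x) = act g (x \<otimes> y) \<otimes> inv (x \<otimes> y)"
        using T g by (simp add: T.inv_mult_group T.m_assoc)
      finally show ?thesis .
    qed
    then show "x \<otimes> y \<in> act_fixed H"
      using T by (simp add: act_fixed_def)
  qed (auto simp: act_fixed_def)
  fix h x assume h: "h \<in> carrier G" and x: "x \<in> act_fixed H"
  then have xT: "x \<in> carrier T"
    by (simp add: act_fixed_def)
  have "act g (act h x) \<otimes> inv act h x \<in> H" if g: "g \<in> carrier G" for g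
  proof -
    \<comment> \<open>Moving \<open>h\<close> past \<open>g\<close> replaces \<open>g\<close> by its
      conjugate \<open>?k\<close>, so the condition on \<open>x\<close> at \<open>?k\<close>,
      carried over by \<open>h\<close>, is the one wanted.\<close>
    let ?k = "inv\<^bsub>G\<^esub> h \<otimes>\<^bsub>G\<^esub> g \<otimes>\<^bsub>G\<^esub> h"
    have "act h (act ?k x \<otimes> inv x) \<in> H"
      using x h g by (intro act_subgroupD(2)[OF H]) (auto simp: act_fixed_def)
    also have "act h (act ?k x \<otimes> inv x) = act g (act h x) \<otimes> inv act h x"
      using xT h g by (simp add: G.m_assoc flip: act_comp)
    finally show ?thesis .
  qed
  then show "act h x \<in> act_fixed H"
    using xT h by (simp add: act_fixed_def)
qed

text \<open>Modulo \<open>H\<close>, the element \<open>d\<close> is central and fixed by the action, so that \<open>act (g\<^sup>i) a\<close> is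
  \<open>d\<^sup>i a\<close>.\<close>

lemma twisted_product_mem:
  assumes p: "odd (p::nat)" and H: "act_subgroup H" and pow: "\<And>t. t \<in> carrier T \<Longrightarrow> t [^] p \<in> H"
    and g: "g \<in> carrier G" and a: "a \<in> carrier T" and d: "d \<in> act_fixed H" "act g a = d \<otimes> a"
    and f: "f 0 = \<one>" "\<And>i. f (Suc i) = f i \<otimes> act (g [^]\<^bsub>G\<^esub> i) a"
  shows "f p \<in> H"
proof -
  interpret H: normal H T
    using H by (rule act_subgroup_normal)
  define r where "r x = H #> x" for x
  define Q where "Q = T Mod H"
  interpret r: group_hom T Q r
    unfolding r_def Q_def
    by (intro group_hom.intro group_hom_axioms.intro T.is_group H.factorgroup_is_group H.r_coset_hom_Mod)
  have r_one: "r x = \<one>\<^bsub>Q\<^esub> \<longleftrightarrow> x \<in> H" if "x \<in> carrier T" for x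
    using that H.rcos_const[OF T.is_group] T.rcos_self[OF that H.subgroup_axioms] by (auto simp: r_def Q_def)
  have dT: "d \<in> carrier T"
    using d(1) by (simp add: act_fixed_def)
  have r_d: "r (act h d) = r d" if "h \<in> carrier G" for h
  proof -
    have "r (act h d \<otimes> inv d) = \<one>\<^bsub>Q\<^esub>"
      using d(1) dT that by (subst r_one) (auto simp: act_fixed_def)
    then show ?thesis
      using dT that by (simp add: r.H.inv_solve_right')
  qed
  \<comment> \<open>Conjugation by \<open>a\<close> is part of the action and \<open>d\<close> is
    fixed modulo \<open>H\<close>, so the two commute modulo \<open>H\<close>.\<close>
  have comm: "r d \<otimes>\<^bsub>Q\<^esub> r a = r a \<otimes>\<^bsub>Q\<^esub> r d"
  proof -
    have "r (a \<otimes> d \<otimes> inv a) = r d"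
      using a dT by (simp only: conj_eq_act) (simp add: r_d)
    then have "r a \<otimes>\<^bsub>Q\<^esub> r d = r d \<otimes>\<^bsub>Q\<^esub> r a"
      using a dT by (simp add: r.H.inv_solve_right')
    then show ?thesis ..
  qed
  have r_pow: "r (act (g [^]\<^bsub>G\<^esub> i) a) = r d [^]\<^bsub>Q\<^esub> i \<otimes>\<^bsub>Q\<^esub> r a" for i :: nat
  proof (induction i)
    case 0
    then show ?case using a by (simp add: act_one)
  next
    case (Suc i)
    have "r (act (g [^]\<^bsub>G\<^esub> Suc i) a) = r (act (g [^]\<^bsub>G\<^esub> i) d) \<otimes>\<^bsub>Q\<^esub> r (act (g [^]\<^bsub>G\<^esub> i) a)"
      using a g d(2) dT by (simp add: act_comp)
    also have "\<dots> = r d [^]\<^bsub>Q\<^esub> Suc i \<otimes>\<^bsub>Q\<^esub> r a"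
      using a g dT r.H.nat_pow_Suc2[of "r d" i] by (simp add: r_d Suc r.H.m_assoc)
    finally show ?case .
  qed
  have f_closed: "f i \<in> carrier T" for i
    by (induction i) (use f a g in auto)
  have "r (f p) = \<one>\<^bsub>Q\<^esub>"
  proof (rule r.H.twisted_power_trivial[OF p])
    show "x [^]\<^bsub>Q\<^esub> p = \<one>\<^bsub>Q\<^esub>" if "x \<in> carrier (Q)" for x
    proof -
      obtain t where t: "t \<in> carrier T" "x = r t"
        using \<open>x \<in> carrier (Q)\<close> by (auto simp: FactGroup_def RCOSETS_def r_def Q_def)
      then have "r (t [^] p) = \<one>\<^bsub>Q\<^esub>"
        using pow by (simp only: r_one T.nat_pow_closed)
      then show ?thesis
        using t by (simp only: r.hom_nat_pow)
    qed
    show "r (f (Suc i)) = r (f i) \<otimes>\<^bsub>Q\<^esub> (r d [^]\<^bsub>Q\<^esub> i \<otimes>\<^bsub>Q\<^esub> r a)" for i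
      using f_closed a g by (simp only: f(2) r.hom_mult act_closed G.nat_pow_closed r_pow)
  qed (use a dT comm f(1) in auto)
  then show ?thesis
    using r_one f_closed by simp
qed

text \<open>Inversion reverses the product and reduces it to \<open>twisted_product_mem\<close> for
  \<open>inv a\<close>; the twist becomes a conjugate of \<open>inv d\<close>.\<close>

lemma twisted_product_mem':
  assumes p: "odd (p::nat)" and H: "act_subgroup H" and pow: "\<And>t. t \<in> carrier T \<Longrightarrow> t [^] p \<in> H"
    and g: "g \<in> carrier G" and a: "a \<in> carrier T" and d: "d \<in> act_fixed H" "act g a = d \<otimes> a"
    and f: "f 0 = \<one>" "\<And>i. f (Suc i) = act (g [^]\<^bsub>G\<^esub> i) a \<otimes> f i"
  shows "f p \<in> H"
proof -
  interpret H: subgroup H T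
    using H by (rule act_subgroupD)
  interpret F: normal "act_fixed H" T
    using act_fixed_act_subgroup[OF H] by (rule act_subgroup_normal)
  have f_closed: "f i \<in> carrier T" for i
    by (induction i) (use f a g in auto)
  have "inv (f p) \<in> H"
  proof (rule twisted_product_mem[OF p H pow g, of "inv a"])
    show "inv a \<otimes> inv d \<otimes> a \<in> act_fixed H"
      using a d(1) by (intro F.inv_op_closed1 F.m_inv_closed)
    show "act g (inv a) = inv a \<otimes> inv d \<otimes> a \<otimes> inv a"
      using a g d F.mem_carrier[OF d(1)] by (simp add: T.m_assoc T.inv_mult_group)
    show "inv (f (Suc i)) = inv (f i) \<otimes> act (g [^]\<^bsub>G\<^esub> i) (inv a)" for i
      using a g f(2) f_closed by (simp add: T.inv_mult_group)
  qed (use a f in auto)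
  then have "inv (inv (f p)) \<in> H"
    by (rule H.m_inv_closed)
  then show ?thesis
    using f_closed by simp
qed

end

section \<open>The tensor product is powerful\<close>

locale powerful_crossed_tensor = crossed_tensor +
  fixes p :: nat
  assumes prime: "Factorial_Ring.prime p" and odd: "odd p"
    and powerful_source: "powerful p M"
    and powerfully_embedded_image: "powerfully_embedded p (\<mu> ` carrier M) G"
begin

lemma finite_p_groups: "finite_p_group p M" "finite_p_group p G" "finite_p_group p T"
  using powerful_source powerfully_embedded_image finite_p_group_tensor[OF prime]
  by (simp_all add: powerful_def powerfully_embedded_def)

abbreviation source_power where
  "source_power \<equiv> power_subgroup M (carrier M) p"

abbreviation image_power where
  "image_power \<equiv> power_subgroup G (\<mu> ` carrier M) p"

abbreviation tensor_power where
  "tensor_power \<equiv> power_subgroup T (carrier T) p"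

lemma subgroups:
  "subgroup source_power M" "subgroup image_power G" "subgroup tensor_power T"
  by (rule M.power_subgroup_is_subgroup G.power_subgroup_is_subgroup T.power_subgroup_is_subgroup, force)+

lemma boundary_source_power: "\<mu> ` source_power = image_power"
  by (rule boundary.image_power_subgroup) simp

lemma source_commutator:
  assumes "k \<in> carrier M" "m \<in> carrier M"
  shows "k \<otimes>\<^bsub>M\<^esub> m \<otimes>\<^bsub>M\<^esub> inv\<^bsub>M\<^esub> k \<otimes>\<^bsub>M\<^esub> inv\<^bsub>M\<^esub> m \<in> source_power"
proof -
  have "k \<otimes>\<^bsub>M\<^esub> m \<otimes>\<^bsub>M\<^esub> inv\<^bsub>M\<^esub> k \<otimes>\<^bsub>M\<^esub> inv\<^bsub>M\<^esub> m \<in> commutator_subgroup M (carrier M) (carrier M)"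
    unfolding commutator_subgroup_def using assms by (blast intro: generate.incl)
  then show ?thesis
    using powerful_source by (auto simp: powerful_def)
qed

lemma image_commutator:
  assumes "m \<in> carrier M" "g \<in> carrier G"
  shows "\<mu> m \<otimes>\<^bsub>G\<^esub> g \<otimes>\<^bsub>G\<^esub> inv\<^bsub>G\<^esub> \<mu> m \<otimes>\<^bsub>G\<^esub> inv\<^bsub>G\<^esub> g \<in> image_power"
proof -
  have "\<mu> m \<otimes>\<^bsub>G\<^esub> g \<otimes>\<^bsub>G\<^esub> inv\<^bsub>G\<^esub> \<mu> m \<otimes>\<^bsub>G\<^esub> inv\<^bsub>G\<^esub> g \<in> commutator_subgroup G (\<mu> ` carrier M) (carrier G)"
    unfolding commutator_subgroup_def using assms by (blast intro: generate.incl)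
  then show ?thesis
    using powerfully_embedded_image by (auto simp: powerfully_embedded_def)
qed

text \<open>The bottom of the series used below: each \<open>act g\<close> is an endomorphism and
  sends p-th powers to p-th powers.\<close>

lemma tensor_power_act_subgroup: "act_subgroup tensor_power"
  unfolding act_subgroup_def
proof (intro conjI ballI)
  show "subgroup tensor_power T"
    by (rule subgroups)
  fix g h assume g: "g \<in> carrier G" and h: "h \<in> tensor_power"
  have "act g ` tensor_power = power_subgroup T (act g ` carrier T) p"
    using group_hom.image_power_subgroup[OF act_group_hom[OF g]] by blast
  also have "\<dots> \<subseteq> tensor_power"
    unfolding power_subgroup_def using g by (intro T.mono_generate) auto
  finally show "act g h \<in> tensor_power"
    using h by blast
qed

text \<open>Two kinds of tensors are treated together: expanding a p-th power in the right entry
  produces correction terms of both kinds, and in the left entry terms of the first kind.\<close>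

definition power_tensors where
  "power_tensors = {\<tau> m b | m b. m \<in> carrier M \<and> b \<in> image_power} \<union>
     {\<tau> a (\<mu> k) | a k. a \<in> source_power \<and> k \<in> carrier M}"

lemma power_tensorsI:
  "m \<in> carrier M \<Longrightarrow> b \<in> image_power \<Longrightarrow> \<tau> m b \<in> power_tensors"
  "a \<in> source_power \<Longrightarrow> k \<in> carrier M \<Longrightarrow> \<tau> a (\<mu> k) \<in> power_tensors"
  unfolding power_tensors_def by blast+

text \<open>One step down the series. A tensor with a p-th power as an entry is a product of
  \<open>p\<close> twisted factors whose twist is built from \<open>power_tensors\<close>, hence
  fixed modulo \<open>H\<close>; the twisted product lemmas then apply.\<close>

lemma power_tensors_descend:
  assumes H: "act_subgroup H" and pow: "tensor_power \<subseteq> H" and fixed: "power_tensors \<subseteq> act_fixed H"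
  shows "power_tensors \<subseteq> H"
proof -
  interpret H: subgroup H T
    using H by (rule act_subgroupD)
  interpret F: normal "act_fixed H" T
    using act_fixed_act_subgroup[OF H] by (rule act_subgroup_normal)
  have act_H: "act g h \<in> H" if "g \<in> carrier G" "h \<in> H" for g h
    using act_subgroupD(2)[OF H] that by blast
  have pow_H: "t [^] p \<in> H" if "t \<in> carrier T" for t
    using T.power_in_power_subgroup[OF that] pow by blast
  have right_power: "\<tau> m (\<mu> k [^]\<^bsub>G\<^esub> p) \<in> H" if mk: "m \<in> carrier M" "k \<in> carrier M" for m k
  proof -
    let ?a = "\<tau> m (\<mu> k)"
    \<comment> \<open>\<open>z\<close> describes how \<open>\<mu> k\<close> moves \<open>m\<close>,
      and it lies in \<open>source_power\<close> because \<open>M\<close> is powerful. As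
      \<open>\<mu> k\<close> commutes with itself, its action on \<open>?a\<close> multiplies just
      the left entry by \<open>z\<close>.\<close>
    define z where "z = k \<otimes>\<^bsub>M\<^esub> m \<otimes>\<^bsub>M\<^esub> inv\<^bsub>M\<^esub> k \<otimes>\<^bsub>M\<^esub> inv\<^bsub>M\<^esub> m"
    have z: "z \<in> source_power" "z \<in> carrier M"
      using source_commutator[OF mk(2,1)] mk by (simp_all add: z_def)
    have \<mu>z: "\<mu> z \<in> image_power"
      using z(1) boundary_source_power by blast
    let ?x = "\<tau> (lam ?a) (\<mu> z)" and ?y = "\<tau> z (\<mu> k)"
    have x: "?x \<in> act_fixed H" and y: "?y \<in> act_fixed H"
      using fixed power_tensorsI \<mu>z z(1) mk by auto
    have "\<alpha> (\<mu> k) m = z \<otimes>\<^bsub>M\<^esub> m"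
      using mk by (simp add: z_def peiffer M.m_assoc)
    then have "act (\<mu> k) ?a = act (\<mu> z) ?a \<otimes> ?y"
      using mk z by (simp add: act_tensor tensor_mult_left G.m_assoc)
    \<comment> \<open>By \<open>tensor_lam_left\<close> the action of \<open>\<mu> z\<close> moves
      \<open>?a\<close> by a tensor with right entry in \<open>image_power\<close>.\<close>
    also have "act (\<mu> z) ?a = inv ?x \<otimes> ?a"
      using mk z tensor_lam_left[of ?a "\<mu> z"] by (simp add: T.inv_mult_group T.m_assoc)
    finally have "act (\<mu> k) ?a = (inv ?x \<otimes> (?a \<otimes> ?y \<otimes> inv ?a)) \<otimes> ?a"
      using mk z F.mem_carrier[OF x] by (simp add: T.m_assoc)
    moreover have "inv ?x \<otimes> (?a \<otimes> ?y \<otimes> inv ?a) \<in> act_fixed H"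
      using mk by (intro F.m_closed F.m_inv_closed[OF x] F.inv_op_closed2[OF _ y]) simp
    \<comment> \<open>The right relation is the required recursion, with each new factor appended at
      the end.\<close>
    ultimately show ?thesis
      using twisted_product_mem[OF odd H pow_H, of "\<mu> k" ?a _ "\<lambda>i. \<tau> m (\<mu> k [^]\<^bsub>G\<^esub> i)"] mk
      by (simp add: tensor_one_right tensor_mult_right)
  qed
  have left_power: "\<tau> (m [^]\<^bsub>M\<^esub> p) (\<mu> k) \<in> H" if mk: "m \<in> carrier M" "k \<in> carrier M" for m k
  proof -
    let ?a = "\<tau> m (\<mu> k)"
    \<comment> \<open>Now the right entry moves: \<open>w\<close> is the commutator by which
      \<open>\<mu> m\<close> changes \<open>\<mu> k\<close>, and it lies in
      \<open>image_power\<close> by powerful embedding.\<close>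
    define w where "w = \<mu> m \<otimes>\<^bsub>G\<^esub> \<mu> k \<otimes>\<^bsub>G\<^esub> inv\<^bsub>G\<^esub> \<mu> m \<otimes>\<^bsub>G\<^esub> inv\<^bsub>G\<^esub> \<mu> k"
    have w: "w \<in> image_power" "w \<in> carrier G"
      using image_commutator[OF mk(1), of "\<mu> k"] mk by (simp_all add: w_def)
    let ?x = "\<tau> m w" and ?y = "\<tau> (lam ?a) w"
    have x: "?x \<in> act_fixed H" and y: "?y \<in> act_fixed H"
      using fixed power_tensorsI(1) w(1) mk by auto
    have "conjugate (\<mu> m) (\<mu> k) = w \<otimes>\<^bsub>G\<^esub> \<mu> k"
      using mk by (simp add: w_def G.m_assoc)
    then have "act (\<mu> m) ?a = ?x \<otimes> act w ?a"
      using mk w act_tensor[of "\<mu> m" m "\<mu> k"] tensor_mult_right[of m w "\<mu> k"]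
      by (simp add: peiffer M.m_assoc)
    also have "act w ?a = inv ?y \<otimes> ?a"
      using mk w tensor_lam_left[of ?a w] by (simp add: T.inv_mult_group T.m_assoc)
    finally have "act (\<mu> m) ?a = (?x \<otimes> inv ?y) \<otimes> ?a"
      using mk w F.mem_carrier[OF y] by (simp add: T.m_assoc)
    moreover have "?x \<otimes> inv ?y \<in> act_fixed H"
      by (intro F.m_closed F.m_inv_closed x y)
    \<comment> \<open>The left relation puts each new factor in front, hence the reversed
      version.\<close>
    ultimately show ?thesis
      using twisted_product_mem'[OF odd H pow_H, of "\<mu> m" ?a _ "\<lambda>i. \<tau> (m [^]\<^bsub>M\<^esub> i) (\<mu> k)"] mk
      by (simp add: tensor_one_left tensor_mult_left boundary.hom_nat_pow)
  qed
  have right: "\<tau> m b \<in> H" if "m \<in> carrier M" "b \<in> image_power" for m b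
  proof -
    \<comment> \<open>Invariance of \<open>H\<close> makes the admissible right entries a subgroup,
      so p-th powers of boundary values suffice. Left entries are handled in the same way
      below.\<close>
    have "subgroup {b \<in> carrier G. \<forall>m\<in>carrier M. \<tau> m b \<in> H} G"
    proof (rule G.subgroupI)
      fix b assume b: "b \<in> {b \<in> carrier G. \<forall>m\<in>carrier M. \<tau> m b \<in> H}"
      have "\<tau> m (inv\<^bsub>G\<^esub> b) \<in> H" if "m \<in> carrier M" for m
      proof -
        have "inv act (inv\<^bsub>G\<^esub> b) (\<tau> m b) = \<tau> m (inv\<^bsub>G\<^esub> b)"
          using b that tensor_mult_right[of m "inv\<^bsub>G\<^esub> b" b]
          by (intro T.inv_equality) (simp_all add: tensor_one_right)
        moreover have "inv act (inv\<^bsub>G\<^esub> b) (\<tau> m b) \<in> H"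
          using b that by (intro H.m_inv_closed act_H) auto
        ultimately show ?thesis
          by simp
      qed
      then show "inv\<^bsub>G\<^esub> b \<in> {b \<in> carrier G. \<forall>m\<in>carrier M. \<tau> m b \<in> H}"
        using b by simp
    next
      fix b b' assume "b \<in> {b \<in> carrier G. \<forall>m\<in>carrier M. \<tau> m b \<in> H}" "b' \<in> {b \<in> carrier G. \<forall>m\<in>carrier M. \<tau> m b \<in> H}"
      then show "b \<otimes>\<^bsub>G\<^esub> b' \<in> {b \<in> carrier G. \<forall>m\<in>carrier M. \<tau> m b \<in> H}"
        by (simp add: tensor_mult_right act_H H.m_closed)
    qed (auto simp: tensor_one_right intro!: exI[of _ "\<one>\<^bsub>G\<^esub>"])
    then have "image_power \<subseteq> {b \<in> carrier G. \<forall>m\<in>carrier M. \<tau> m b \<in> H}"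
      unfolding power_subgroup_def using right_power by (intro G.generate_subgroup_incl) auto
    then show ?thesis
      using that by blast
  qed
  have left: "\<tau> a (\<mu> k) \<in> H" if "a \<in> source_power" "k \<in> carrier M" for a k
  proof -
    have "subgroup {a \<in> carrier M. \<forall>k\<in>carrier M. \<tau> a (\<mu> k) \<in> H} M"
    proof (rule M.subgroupI)
      fix a assume a: "a \<in> {a \<in> carrier M. \<forall>k\<in>carrier M. \<tau> a (\<mu> k) \<in> H}"
      have "\<tau> (inv\<^bsub>M\<^esub> a) (\<mu> k) \<in> H" if "k \<in> carrier M" for k
      proof -
        have "\<tau> (inv\<^bsub>M\<^esub> a) (\<mu> k) = act (inv\<^bsub>G\<^esub> \<mu> a) (inv \<tau> a (\<mu> k))"
          using a that tensor_inv_left[of a "\<mu> k"] act_inverse(2)[of "\<mu> a" "\<tau> (inv\<^bsub>M\<^esub> a) (\<mu> k)"]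
          by (simp del: act_inv act_inverse)
        then show ?thesis
          using a that by (simp add: act_H H.m_inv_closed del: act_inv)
      qed
      then show "inv\<^bsub>M\<^esub> a \<in> {a \<in> carrier M. \<forall>k\<in>carrier M. \<tau> a (\<mu> k) \<in> H}"
        using a by simp
    next
      fix a a' assume "a \<in> {a \<in> carrier M. \<forall>k\<in>carrier M. \<tau> a (\<mu> k) \<in> H}" "a' \<in> {a \<in> carrier M. \<forall>k\<in>carrier M. \<tau> a (\<mu> k) \<in> H}"
      then show "a \<otimes>\<^bsub>M\<^esub> a' \<in> {a \<in> carrier M. \<forall>k\<in>carrier M. \<tau> a (\<mu> k) \<in> H}"
        by (simp add: tensor_mult_left act_H H.m_closed)
    qed (auto simp: tensor_one_left intro!: exI[of _ "\<one>\<^bsub>M\<^esub>"])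
    then have "source_power \<subseteq> {a \<in> carrier M. \<forall>k\<in>carrier M. \<tau> a (\<mu> k) \<in> H}"
      unfolding power_subgroup_def using left_power by (intro M.generate_subgroup_incl) auto
    then show ?thesis
      using that by blast
  qed
  show ?thesis
    unfolding power_tensors_def using right left by blast
qed

text \<open>Since \<open>G\<close> acts nilpotently on the \<open>p\<close>-group \<open>T\<close>, iterating \<open>act_fixed\<close> leads from
  \<open>tensor_power\<close> up to all of \<open>T\<close>.\<close>

lemma power_tensors_subset: "power_tensors \<subseteq> tensor_power"
proof -
  \<comment> \<open>Members of \<open>F\<close> are stages from which the containment can be pulled
    down to \<open>tensor_power\<close>. \<open>power_tensors_descend\<close> keeps \<open>F\<close>
    closed under \<open>act_fixed\<close>, and finiteness supplies a maximal member.\<close>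
  define F where "F = {Z. act_subgroup Z \<and> tensor_power \<subseteq> Z \<and> (power_tensors \<subseteq> Z \<longrightarrow> power_tensors \<subseteq> tensor_power)}"
  have fin: "finite (carrier T)"
    using finite_p_groups(3) by (simp add: finite_p_group_def)
  have "F \<subseteq> Pow (carrier T)"
    using act_subgroupD(1) subgroup.subset by (fastforce simp: F_def)
  then have "finite F"
    using fin by (meson finite_Pow_iff finite_subset)
  moreover have "tensor_power \<in> F"
    by (simp add: F_def tensor_power_act_subgroup)
  ultimately obtain Z where Z: "Z \<in> F" and max: "\<And>Y. Y \<in> F \<Longrightarrow> Z \<subseteq> Y \<Longrightarrow> Z = Y"
    using finite_has_maximal[of F] by blast
  have Zact: "act_subgroup Z"
    using Z by (simp add: F_def)
  have "act_fixed Z \<in> F"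
    using Z act_fixed_act_subgroup[OF Zact] subset_act_fixed[OF Zact] power_tensors_descend[OF Zact]
    by (auto simp: F_def)
  then have fixed: "Z = act_fixed Z"
    using max subset_act_fixed[OF Zact] by blast
  \<comment> \<open>A proper invariant subgroup would miss some element fixed modulo it,
    contradicting that \<open>Z\<close> is its own \<open>act_fixed\<close>.\<close>
  have "Z = carrier T"
  proof (rule ccontr)
    assume "Z \<noteq> carrier T"
    from nilpotent_action[OF prime finite_p_groups(2,3) act_hom act_comp act_one
        act_subgroup_normal[OF Zact] this act_subgroupD(2)[OF Zact]]
    show False
      using fixed by (auto simp: act_fixed_def)
  qed
  moreover have "power_tensors \<subseteq> carrier T"
    unfolding power_tensors_def using subgroup.mem_carrier[OF subgroups(1)] subgroup.mem_carrier[OF subgroups(2)] by auto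
  ultimately show ?thesis
    using Z by (simp add: F_def)
qed

lemma tensor_image_power:
  "m \<in> carrier M \<Longrightarrow> b \<in> image_power \<Longrightarrow> \<tau> m b \<in> tensor_power"
  using power_tensorsI(1) power_tensors_subset by blast

text \<open>On a generator the value is the commutator of \<open>\<mu> m\<close> and
  \<open>g\<close>, to which powerful embedding applies.\<close>

lemma boundary_lam_mem:
  assumes "t \<in> carrier T"
  shows "\<mu> (lam t) \<in> image_power"
proof -
  interpret B: subgroup image_power G
    by (rule subgroups)
  show ?thesis
    using assms
  proof (induction t rule: tensor_induct)
    case (tensor m g)
    then show ?case
      using image_commutator[of m g]
      by (simp add: lam_tensor equivariant G.m_assoc)
  qed auto
qed

text \<open>The commutator is a tensor with right entry \<open>\<mu> (lam u)\<close>, which lies in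
  \<open>image_power\<close>.\<close>

lemma tensor_commutator:
  "t \<in> carrier T \<Longrightarrow> u \<in> carrier T \<Longrightarrow> t \<otimes> u \<otimes> inv t \<otimes> inv u \<in> tensor_power"
  by (simp add: commutator_eq_tensor tensor_image_power boundary_lam_mem)

theorem powerful_tensor: "powerful p T"
proof -
  have "commutator_subgroup T (carrier T) (carrier T) \<subseteq> tensor_power"
    unfolding commutator_subgroup_def
    using tensor_commutator subgroups(3) by (intro T.generate_subgroup_incl) auto
  then show ?thesis
    using finite_p_groups(3) by (simp add: powerful_def)
qed

end

section \<open>The tensor product modulo $p$\<close>

lemma (in group) power_subgroup_normal: "power_subgroup G (carrier G) p \<lhd> G"
  unfolding power_subgroup_def
proof (rule normal_generateI)
  fix h g assume "h \<in> {x [^] p | x. x \<in> carrier G}" and g: "g \<in> carrier G"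
  then obtain x where x: "x \<in> carrier G" "h = x [^] p"
    by blast
  have "group_hom G G (\<lambda>x. g \<otimes> x \<otimes> inv g)"
    using g by (intro group_hom.intro group_hom_axioms.intro is_group homI) (auto simp: m_assoc)
  then have "g \<otimes> h \<otimes> inv g = (g \<otimes> x \<otimes> inv g) [^] p"
    using group_hom.hom_nat_pow[of G G _ x p] x by simp
  then show "g \<otimes> h \<otimes> inv g \<in> {x [^] p | x. x \<in> carrier G}"
    using g x by blast
qed auto

lemma (in normal) rcos_eq_one_iff:
  assumes "x \<in> carrier G"
  shows "H #> x = \<one>\<^bsub>G Mod H\<^esub> \<longleftrightarrow> x \<in> H"
  using assms rcos_const[OF is_group] rcos_self[OF assms subgroup_axioms] by auto

text \<open>The quotient by \<open>H\<close> is generated by commuting images, hence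
  abelian.\<close>

lemma (in normal) commutators_mem_if_generators:
  assumes S: "S \<subseteq> carrier G" "generate G S = carrier G"
    and comm: "\<And>x y. x \<in> S \<Longrightarrow> y \<in> S \<Longrightarrow> x \<otimes> y \<otimes> inv x \<otimes> inv y \<in> H"
    and xy: "x \<in> carrier G" "y \<in> carrier G"
  shows "x \<otimes> y \<otimes> inv x \<otimes> inv y \<in> H"
proof -
  define r where "r x = H #> x" for x
  define Q where "Q = G Mod H"
  interpret r: group_hom G Q r
    unfolding r_def Q_def
    by (intro group_hom.intro group_hom_axioms.intro is_group factorgroup_is_group r_coset_hom_Mod)
  have iff: "r x \<otimes>\<^bsub>Q\<^esub> r y = r y \<otimes>\<^bsub>Q\<^esub> r x \<longleftrightarrow> x \<otimes> y \<otimes> inv x \<otimes> inv y \<in> H"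
    if "x \<in> carrier G" "y \<in> carrier G" for x y
  proof -
    have "x \<otimes> y \<otimes> inv x \<otimes> inv y \<in> H \<longleftrightarrow> r (x \<otimes> y \<otimes> inv (y \<otimes> x)) = \<one>\<^bsub>Q\<^esub>"
      using that rcos_eq_one_iff[of "x \<otimes> y \<otimes> inv (y \<otimes> x)"]
      by (simp add: r_def Q_def inv_mult_group m_assoc)
    also have "\<dots> \<longleftrightarrow> r x \<otimes>\<^bsub>Q\<^esub> r y = r y \<otimes>\<^bsub>Q\<^esub> r x"
      using that by (simp add: r.H.inv_solve_right' del: inv_mult_group)
    finally show ?thesis ..
  qed
  have "r ` carrier G = carrier Q"
    by (auto simp: r_def Q_def FactGroup_def RCOSETS_def)
  then have "generate Q (r ` S) = carrier Q"
    using r.generate_img[OF S(1)] S(2) by simp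
  moreover have "r ` S \<subseteq> carrier Q"
    using S(1) by auto
  moreover have "a \<otimes>\<^bsub>Q\<^esub> b = b \<otimes>\<^bsub>Q\<^esub> a" if "a \<in> r ` S" "b \<in> r ` S" for a b
  proof -
    obtain u v where "u \<in> S" "a = r u" "v \<in> S" "b = r v"
      using \<open>a \<in> r ` S\<close> \<open>b \<in> r ` S\<close> by blast
    then show ?thesis
      using iff[of u v] comm[of u v] S(1) by blast
  qed
  ultimately have "r x \<otimes>\<^bsub>Q\<^esub> r y = r y \<otimes>\<^bsub>Q\<^esub> r x"
    using xy r.H.commutes_if_generators_commute[of "r ` S" "r x" "r y"] by simp
  then show ?thesis
    using iff xy by blast
qed

text \<open>Braces are indexed by \<open>M\<close> alone, since over the identity of
  \<open>G\<close> a pair in the fibre product is determined by its first entry.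
  \<open>brace_mult\<close> summarises the middle product of the expansion as one element of the
  image of \<open>T\<close>.\<close>

locale powerful_crossed_tensor_mod = powerful_crossed_tensor M G \<mu> \<alpha> T \<tau> lam act p + S: group S
  for M :: "('m, 'a) monoid_scheme" and G :: "('g, 'b) monoid_scheme" and \<mu> \<alpha>
    and T :: "('t, 'c) monoid_scheme" (structure) and \<tau> lam act p and S :: "('s, 'd) monoid_scheme" +
  fixes \<iota> :: "'t \<Rightarrow> 's" and br :: "'m \<Rightarrow> 's"
  assumes embed_hom: "\<iota> \<in> hom T S"
    and brace_closed [simp]: "k \<in> carrier M \<Longrightarrow> br k \<in> carrier S"
    and generates_mod: "generate S (\<iota> ` carrier T \<union> br ` carrier M) = carrier S"
    and brace_conj_tensor: "\<lbrakk>k \<in> carrier M; m \<in> carrier M; g \<in> carrier G\<rbrakk> \<Longrightarrow>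
      br k \<otimes>\<^bsub>S\<^esub> \<iota> (\<tau> m g) \<otimes>\<^bsub>S\<^esub> inv\<^bsub>S\<^esub> br k = \<iota> (act (\<mu> (k [^]\<^bsub>M\<^esub> p)) (\<tau> m g))"
    and brace_mult: "\<lbrakk>k \<in> carrier M; k' \<in> carrier M\<rbrakk> \<Longrightarrow>
      \<exists>t\<in>carrier T. br (k \<otimes>\<^bsub>M\<^esub> k') = br k \<otimes>\<^bsub>S\<^esub> \<iota> t \<otimes>\<^bsub>S\<^esub> br k'"
    and brace_commutator: "\<lbrakk>k \<in> carrier M; k' \<in> carrier M\<rbrakk> \<Longrightarrow>
      br k \<otimes>\<^bsub>S\<^esub> br k' \<otimes>\<^bsub>S\<^esub> inv\<^bsub>S\<^esub> br k \<otimes>\<^bsub>S\<^esub> inv\<^bsub>S\<^esub> br k' = \<iota> (\<tau> (k [^]\<^bsub>M\<^esub> p) (\<mu> (k' [^]\<^bsub>M\<^esub> p)))"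
begin

sublocale embed: group_hom T S \<iota>
  by (intro group_hom.intro group_hom_axioms.intro T.is_group S.is_group embed_hom)

abbreviation mod_generators :: "'s set" where
  "mod_generators \<equiv> \<iota> ` carrier T \<union> br ` carrier M"

lemma mod_generators_closed: "mod_generators \<subseteq> carrier S"
  by auto

text \<open>The relation is given for single tensors and extends because both sides are
  homomorphisms in \<open>t\<close>.\<close>

lemma brace_conj:
  assumes "k \<in> carrier M" "t \<in> carrier T"
  shows "br k \<otimes>\<^bsub>S\<^esub> \<iota> t \<otimes>\<^bsub>S\<^esub> inv\<^bsub>S\<^esub> br k = \<iota> (act (\<mu> (k [^]\<^bsub>M\<^esub> p)) t)"
proof (rule T.hom_eq_on_generators[OF S.is_group tensors_closed tensor_generates _ _ _ assms(2)])
  show "(\<lambda>t. br k \<otimes>\<^bsub>S\<^esub> \<iota> t \<otimes>\<^bsub>S\<^esub> inv\<^bsub>S\<^esub> br k) \<in> hom T S"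
    using assms by (intro homI) (auto simp: S.m_assoc)
  show "(\<lambda>t. \<iota> (act (\<mu> (k [^]\<^bsub>M\<^esub> p)) t)) \<in> hom T S"
    using assms by (intro homI) auto
qed (use assms brace_conj_tensor in auto)

lemma embed_normal: "\<iota> ` carrier T \<lhd> S"
  unfolding S.normal_inv_iff
proof (intro conjI ballI)
  show "subgroup (\<iota> ` carrier T) S"
    by (rule embed.img_is_subgroup)
  fix s h assume s: "s \<in> carrier S" and h: "h \<in> \<iota> ` carrier T"
  have "s \<in> generate S mod_generators"
    using s generates_mod by simp
  then have "\<forall>h\<in>\<iota> ` carrier T. s \<otimes>\<^bsub>S\<^esub> h \<otimes>\<^bsub>S\<^esub> inv\<^bsub>S\<^esub> s \<in> \<iota> ` carrier T"
  proof (induction rule: generate.induct)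
    case (incl s)
    then show ?case
      using brace_conj by (auto simp flip: embed.hom_mult embed.hom_inv)
  next
    case (inv s)
    then consider t where "t \<in> carrier T" "s = \<iota> t" | k where "k \<in> carrier M" "s = br k"
      by blast
    then show ?case
    proof cases
      case 1
      then show ?thesis
        by (auto simp flip: embed.hom_mult embed.hom_inv)
    next
      case 2
      show ?thesis
      proof
        fix h assume "h \<in> \<iota> ` carrier T"
        then obtain t where t: "t \<in> carrier T" "h = \<iota> t"
          by blast
        \<comment> \<open>The action on \<open>T\<close> is invertible, so \<open>h\<close> is
          itself the conjugate by \<open>br k\<close> of an element of the image.\<close>
        let ?u = "act (inv\<^bsub>G\<^esub> \<mu> (k [^]\<^bsub>M\<^esub> p)) t"
        have h: "h = br k \<otimes>\<^bsub>S\<^esub> \<iota> ?u \<otimes>\<^bsub>S\<^esub> inv\<^bsub>S\<^esub> br k"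
          using 2 t brace_conj[of k ?u] by simp
        have "inv\<^bsub>S\<^esub> br k \<otimes>\<^bsub>S\<^esub> h \<otimes>\<^bsub>S\<^esub> br k = \<iota> ?u"
          unfolding h using 2(1) t(1) by (simp add: S.m_assoc)
        then show "inv\<^bsub>S\<^esub> s \<otimes>\<^bsub>S\<^esub> h \<otimes>\<^bsub>S\<^esub> inv\<^bsub>S\<^esub> (inv\<^bsub>S\<^esub> s) \<in> \<iota> ` carrier T"
          using 2 t by simp
      qed
    qed
  next
    case (eng s1 s2)
    have s: "s1 \<in> carrier S" "s2 \<in> carrier S"
      using eng.hyps generates_mod by auto
    show ?case
    proof
      fix h assume h: "h \<in> \<iota> ` carrier T"
      have "s1 \<otimes>\<^bsub>S\<^esub> (s2 \<otimes>\<^bsub>S\<^esub> h \<otimes>\<^bsub>S\<^esub> inv\<^bsub>S\<^esub> s2) \<otimes>\<^bsub>S\<^esub> inv\<^bsub>S\<^esub> s1 \<in> \<iota> ` carrier T"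
        using eng.IH h by blast
      also have "s1 \<otimes>\<^bsub>S\<^esub> (s2 \<otimes>\<^bsub>S\<^esub> h \<otimes>\<^bsub>S\<^esub> inv\<^bsub>S\<^esub> s2) \<otimes>\<^bsub>S\<^esub> inv\<^bsub>S\<^esub> s1 =
          s1 \<otimes>\<^bsub>S\<^esub> s2 \<otimes>\<^bsub>S\<^esub> h \<otimes>\<^bsub>S\<^esub> inv\<^bsub>S\<^esub> (s1 \<otimes>\<^bsub>S\<^esub> s2)"
        using s h by (auto simp: S.m_assoc S.inv_mult_group)
      finally show "s1 \<otimes>\<^bsub>S\<^esub> s2 \<otimes>\<^bsub>S\<^esub> h \<otimes>\<^bsub>S\<^esub> inv\<^bsub>S\<^esub> (s1 \<otimes>\<^bsub>S\<^esub> s2) \<in> \<iota> ` carrier T" .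
    qed
  qed auto
  then show "s \<otimes>\<^bsub>S\<^esub> h \<otimes>\<^bsub>S\<^esub> inv\<^bsub>S\<^esub> s \<in> \<iota> ` carrier T"
    using h by blast
qed

text \<open>Modulo the image of \<open>T\<close>, the brace is a homomorphism from \<open>M\<close> onto \<open>S\<close>.\<close>

lemma finite_p_group_mod: "finite_p_group p S"
proof -
  interpret J: normal "\<iota> ` carrier T" S
    by (rule embed_normal)
  define r where "r x = \<iota> ` carrier T #>\<^bsub>S\<^esub> x" for x
  define Q where "Q = S Mod (\<iota> ` carrier T)"
  interpret r: group_hom S Q r
    unfolding r_def Q_def
    by (intro group_hom.intro group_hom_axioms.intro S.is_group J.factorgroup_is_group J.r_coset_hom_Mod)
  have r_one: "r x = \<one>\<^bsub>Q\<^esub> \<longleftrightarrow> x \<in> \<iota> ` carrier T" if "x \<in> carrier S" for x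
    using J.rcos_eq_one_iff[OF that] by (simp add: r_def Q_def)
  have "(\<lambda>k. r (br k)) \<in> hom M Q"
  proof (rule homI)
    fix k k' assume k: "k \<in> carrier M" "k' \<in> carrier M"
    then obtain t where t: "t \<in> carrier T" "br (k \<otimes>\<^bsub>M\<^esub> k') = br k \<otimes>\<^bsub>S\<^esub> \<iota> t \<otimes>\<^bsub>S\<^esub> br k'"
      using brace_mult by blast
    have "r (\<iota> t) = \<one>\<^bsub>Q\<^esub>"
      using t(1) r_one by simp
    then show "r (br (k \<otimes>\<^bsub>M\<^esub> k')) = r (br k) \<otimes>\<^bsub>Q\<^esub> r (br k')"
      using k t by simp
  qed simp
  then interpret rb: group_hom M Q "\<lambda>k. r (br k)"
    by (intro group_hom.intro group_hom_axioms.intro M.is_group r.H.is_group)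
  have surj: "r s \<in> (\<lambda>k. r (br k)) ` carrier M" if s: "s \<in> carrier S" for s
  proof -
    have "r ` mod_generators \<subseteq> (\<lambda>k. r (br k)) ` carrier M"
    proof -
      \<comment> \<open>Elements coming from \<open>T\<close> become trivial, as does the brace of
        the identity, so both kinds of generators lie in the image of \<open>M\<close>.\<close>
      have "r (\<iota> t) = r (br \<one>\<^bsub>M\<^esub>)" if "t \<in> carrier T" for t
        using that r_one[of "\<iota> t"] rb.hom_one by simp
      then show ?thesis
        by blast
    qed
    then have "generate Q (r ` mod_generators) \<subseteq> (\<lambda>k. r (br k)) ` carrier M"
      by (rule r.H.generate_subgroup_incl[OF _ rb.img_is_subgroup])
    then show ?thesis
      using s r.generate_img[OF mod_generators_closed] generates_mod by blast
  qed
  have fin: "finite (carrier M)" "finite (carrier T)"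
    using finite_p_groups by (simp_all add: finite_p_group_def)
  \<comment> \<open>Every coset of the image of \<open>T\<close> contains a brace, so finitely many
    products cover \<open>S\<close>.\<close>
  have "carrier S \<subseteq> (\<lambda>(t, k). \<iota> t \<otimes>\<^bsub>S\<^esub> br k) ` (carrier T \<times> carrier M)"
  proof
    fix s assume s: "s \<in> carrier S"
    then obtain k where k: "k \<in> carrier M" "r s = r (br k)"
      using surj by blast
    then have "s \<otimes>\<^bsub>S\<^esub> inv\<^bsub>S\<^esub> br k \<in> \<iota> ` carrier T"
      using s r_one[of "s \<otimes>\<^bsub>S\<^esub> inv\<^bsub>S\<^esub> br k"] by simp
    then obtain t where "t \<in> carrier T" "s \<otimes>\<^bsub>S\<^esub> inv\<^bsub>S\<^esub> br k = \<iota> t"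
      by blast
    moreover from this have "s = \<iota> t \<otimes>\<^bsub>S\<^esub> br k"
      using s k(1) by (simp add: S.inv_solve_right')
    ultimately show "s \<in> (\<lambda>(t, k). \<iota> t \<otimes>\<^bsub>S\<^esub> br k) ` (carrier T \<times> carrier M)"
      using k(1) by force
  qed
  then have finS: "finite (carrier S)"
    using fin by (meson finite_SigmaI finite_imageI finite_subset)
  \<comment> \<open>The exponent \<open>order M\<close> kills the quotient and leads into the image
    of \<open>T\<close>, where \<open>order T\<close> kills the rest.\<close>
  have exp: "s [^]\<^bsub>S\<^esub> (order M * order T) = \<one>\<^bsub>S\<^esub>" if s: "s \<in> carrier S" for s
  proof -
    obtain k where k: "k \<in> carrier M" "r s = r (br k)"
      using surj[OF s] by blast
    have "r (s [^]\<^bsub>S\<^esub> order M) = \<one>\<^bsub>Q\<^esub>"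
      using s k rb.hom_nat_pow[OF k(1), of "order M"] rb.hom_one M.pow_order_eq_1[OF k(1)]
      by (simp add: r.hom_nat_pow)
    then obtain t where t: "t \<in> carrier T" "s [^]\<^bsub>S\<^esub> order M = \<iota> t"
      using r_one s by auto
    then have "(s [^]\<^bsub>S\<^esub> order M) [^]\<^bsub>S\<^esub> order T = \<one>\<^bsub>S\<^esub>"
      using T.pow_order_eq_1[OF t(1)] embed.hom_nat_pow[OF t(1), of "order T"] by simp
    then show ?thesis
      using s by (simp add: S.nat_pow_pow)
  qed
  obtain a b where "order M = p ^ a" "order T = p ^ b"
    using finite_p_groups by (auto simp: finite_p_group_def)
  then show ?thesis
    using S.finite_p_group_if_exponent[OF finS prime, of "a + b"] exp by (simp add: power_add)
qed

text \<open>Every commutator of two generators is the image of an element of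
  \<open>tensor_power\<close>, so the quotient by p-th powers is abelian.\<close>

theorem powerful_mod: "powerful p S"
proof -
  let ?P = "power_subgroup S (carrier S) p"
  interpret P: normal ?P S
    by (rule S.power_subgroup_normal)
  have embed_power: "\<iota> t \<in> ?P" if "t \<in> tensor_power" for t
  proof -
    have "\<iota> ` tensor_power = power_subgroup S (\<iota> ` carrier T) p"
      by (rule embed.image_power_subgroup) simp
    also have "\<dots> \<subseteq> ?P"
      unfolding power_subgroup_def by (intro S.mono_generate) auto
    finally show ?thesis
      using that by blast
  qed
  have image_power: "\<mu> (k [^]\<^bsub>M\<^esub> p) \<in> image_power" if "k \<in> carrier M" for k
    using that G.power_in_power_subgroup[of "\<mu> k" "\<mu> ` carrier M" p] by (simp add: boundary.hom_nat_pow)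
  have brace_tensor: "br k \<otimes>\<^bsub>S\<^esub> \<iota> t \<otimes>\<^bsub>S\<^esub> inv\<^bsub>S\<^esub> br k \<otimes>\<^bsub>S\<^esub> inv\<^bsub>S\<^esub> \<iota> t \<in> ?P"
    if "k \<in> carrier M" "t \<in> carrier T" for k t
  proof -
    let ?g = "\<mu> (k [^]\<^bsub>M\<^esub> p)"
    \<comment> \<open>Conjugation by the brace is the action of \<open>?g\<close>, so the commutator
      is the image of this defect, an inverse tensor by \<open>tensor_lam_left\<close>.\<close>
    have "act ?g t \<otimes> inv t = inv \<tau> (lam t) ?g"
      using that tensor_lam_left[of t ?g] by (simp add: T.inv_mult_group del: boundary.hom_nat_pow)
    moreover have "inv \<tau> (lam t) ?g \<in> tensor_power"
      using that image_power tensor_image_power subgroup.m_inv_closed[OF subgroups(3)] by simp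
    ultimately have "\<iota> (act ?g t \<otimes> inv t) \<in> ?P"
      using embed_power by simp
    then show ?thesis
      using that brace_conj[of k t] by simp
  qed
  have "x \<otimes>\<^bsub>S\<^esub> y \<otimes>\<^bsub>S\<^esub> inv\<^bsub>S\<^esub> x \<otimes>\<^bsub>S\<^esub> inv\<^bsub>S\<^esub> y \<in> ?P" if "x \<in> mod_generators" "y \<in> mod_generators" for x y
    using that
  proof (elim UnE imageE; hypsubst)
    fix t u assume "t \<in> carrier T" "u \<in> carrier T"
    then show "\<iota> t \<otimes>\<^bsub>S\<^esub> \<iota> u \<otimes>\<^bsub>S\<^esub> inv\<^bsub>S\<^esub> \<iota> t \<otimes>\<^bsub>S\<^esub> inv\<^bsub>S\<^esub> \<iota> u \<in> ?P"
      using embed_power[OF tensor_commutator[of t u]] by simp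
  next
    fix t k assume tk: "t \<in> carrier T" "k \<in> carrier M"
    have "inv\<^bsub>S\<^esub> (br k \<otimes>\<^bsub>S\<^esub> \<iota> t \<otimes>\<^bsub>S\<^esub> inv\<^bsub>S\<^esub> br k \<otimes>\<^bsub>S\<^esub> inv\<^bsub>S\<^esub> \<iota> t) \<in> ?P"
      using brace_tensor[OF tk(2,1)] by (rule P.m_inv_closed)
    then show "\<iota> t \<otimes>\<^bsub>S\<^esub> br k \<otimes>\<^bsub>S\<^esub> inv\<^bsub>S\<^esub> \<iota> t \<otimes>\<^bsub>S\<^esub> inv\<^bsub>S\<^esub> br k \<in> ?P"
      using tk by (simp add: S.inv_mult_group S.m_assoc)
  next
    fix k t assume "k \<in> carrier M" "t \<in> carrier T"
    then show "br k \<otimes>\<^bsub>S\<^esub> \<iota> t \<otimes>\<^bsub>S\<^esub> inv\<^bsub>S\<^esub> br k \<otimes>\<^bsub>S\<^esub> inv\<^bsub>S\<^esub> \<iota> t \<in> ?P"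
      by (rule brace_tensor)
  next
    fix k k' assume "k \<in> carrier M" "k' \<in> carrier M"
    then show "br k \<otimes>\<^bsub>S\<^esub> br k' \<otimes>\<^bsub>S\<^esub> inv\<^bsub>S\<^esub> br k \<otimes>\<^bsub>S\<^esub> inv\<^bsub>S\<^esub> br k' \<in> ?P"
      using brace_commutator[of k k'] embed_power tensor_image_power image_power by simp
  qed
  then have "commutator_subgroup S (carrier S) (carrier S) \<subseteq> ?P"
    unfolding commutator_subgroup_def
    using P.commutators_mem_if_generators[OF mod_generators_closed generates_mod] P.subgroup_axioms
    by (intro S.generate_subgroup_incl) blast+
  then show ?thesis
    using finite_p_group_mod by (simp add: powerful_def)
qed

end

section \<open>Groups given by generators and relations\<close>

lemma words_Nil [simp]: "[] \<in> words S"
  by (simp add: words_def)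

lemma words_Cons [simp]: "(x, b) # w \<in> words S \<longleftrightarrow> x \<in> S \<and> w \<in> words S"
  by (simp add: words_def)

lemma words_append [simp]: "u @ v \<in> words S \<longleftrightarrow> u \<in> words S \<and> v \<in> words S"
  by (simp add: words_def)

lemma word_cong_words:
  assumes "(u, v) \<in> word_cong S R"
  shows "u \<in> words S \<and> v \<in> words S"
  using assms by induction auto

definition word_eval :: "('a, 'b) monoid_scheme \<Rightarrow> ('x \<Rightarrow> 'a) \<Rightarrow> 'x word \<Rightarrow> 'a" where
  "word_eval H f w = foldr (\<lambda>(x, b) y. (if b then f x else inv\<^bsub>H\<^esub> f x) \<otimes>\<^bsub>H\<^esub> y) w \<one>\<^bsub>H\<^esub>"

lemma word_eval_Nil [simp]: "word_eval H f [] = \<one>\<^bsub>H\<^esub>"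
  by (simp add: word_eval_def)

lemma word_eval_Cons [simp]:
  "word_eval H f ((x, b) # w) = (if b then f x else inv\<^bsub>H\<^esub> f x) \<otimes>\<^bsub>H\<^esub> word_eval H f w"
  by (simp add: word_eval_def)

lemma (in group) word_eval_closed:
  assumes "f \<in> S \<rightarrow> carrier G" "w \<in> words S"
  shows "word_eval G f w \<in> carrier G"
  using assms(2) by (induction w) (use assms(1) in \<open>auto simp: Pi_iff\<close>)

lemma (in group) word_eval_append:
  assumes "f \<in> S \<rightarrow> carrier G" "u \<in> words S" "v \<in> words S"
  shows "word_eval G f (u @ v) = word_eval G f u \<otimes> word_eval G f v"
  using assms(2)
proof (induction u)
  case (Cons a u)
  obtain x b where a: "a = (x, b)"
    by (cases a)
  have "f x \<in> carrier G" "word_eval G f u \<in> carrier G" "word_eval G f v \<in> carrier G"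
    using Cons.prems assms(1,3) a by (auto intro: word_eval_closed simp: Pi_iff)
  then show ?case
    using Cons a by (simp add: m_assoc)
qed (simp add: word_eval_closed[OF assms(1,3)])

text \<open>The congruence is generated by cancellation and \<open>R\<close>, and evaluation
  respects both.\<close>

lemma (in group) word_eval_cong:
  assumes f: "f \<in> S \<rightarrow> carrier G"
    and R: "\<And>u v. (u, v) \<in> R \<Longrightarrow> u \<in> words S \<Longrightarrow> v \<in> words S \<Longrightarrow> word_eval G f u = word_eval G f v"
    and "(u, v) \<in> word_cong S R"
  shows "word_eval G f u = word_eval G f v"
  using assms(3)
proof induction
  case (append u u' v v')
  then show ?case
    using word_cong_words word_eval_append[OF f] by metis
next
  case (cancel x b)
  then have "f x \<in> carrier G"
    using f by auto
  then show ?case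
    by simp
qed (use R in auto)

lemma (in group) word_eval_subgroup:
  assumes J: "subgroup J G" and w: "\<And>x b. (x, b) \<in> set w \<Longrightarrow> f x \<in> J"
  shows "word_eval G f w \<in> J"
  using w
proof (induction w)
  case Nil
  then show ?case
    using J by (simp add: subgroup.one_closed)
next
  case (Cons a w)
  obtain x b where a: "a = (x, b)"
    by (cases a)
  have "word_eval G f w \<in> J"
    using Cons by auto
  moreover have "f x \<in> J"
    using Cons.prems a by auto
  ultimately show ?case
    using a J by (simp add: subgroup.m_closed subgroup.m_inv_closed)
qed

definition presented_gen :: "'x set \<Rightarrow> 'x word rel \<Rightarrow> 'x \<Rightarrow> 'x word set" where
  "presented_gen S R x = word_cong S R `` {[(x, True)]}"

lemma equiv_word_cong: "equiv (words S) (word_cong S R)"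
  using word_cong_words
  by (intro equivI refl_onI symI transI) (auto intro: word_cong.intros)

lemma presented_group_carrier: "carrier (presented_group S R) = (\<lambda>w. word_cong S R `` {w}) ` words S"
  by (auto simp: presented_group_def quotient_def)

text \<open>Compatibility of the congruence with concatenation makes the setwise product a single
  class.\<close>

lemma presented_group_mult:
  assumes "u \<in> words S" "v \<in> words S"
  shows "word_cong S R `` {u} \<otimes>\<^bsub>presented_group S R\<^esub> word_cong S R `` {v} = word_cong S R `` {u @ v}"
proof -
  have "word_cong S R `` {u' @ v' | u' v'. u' \<in> word_cong S R `` {u} \<and> v' \<in> word_cong S R `` {v}} =
      word_cong S R `` {u @ v}"
  proof (intro equalityI subsetI)
    fix w assume "w \<in> word_cong S R `` {u' @ v' | u' v'. u' \<in> word_cong S R `` {u} \<and> v' \<in> word_cong S R `` {v}}"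
    then show "w \<in> word_cong S R `` {u @ v}"
      by (auto intro: word_cong.append word_cong.trans)
  next
    fix w assume "w \<in> word_cong S R `` {u @ v}"
    then show "w \<in> word_cong S R `` {u' @ v' | u' v'. u' \<in> word_cong S R `` {u} \<and> v' \<in> word_cong S R `` {v}}"
      using assms by (auto intro: word_cong.refl)
  qed
  then show ?thesis
    by (simp add: presented_group_def)
qed

lemma presented_group_one: "\<one>\<^bsub>presented_group S R\<^esub> = word_cong S R `` {[]}"
  by (simp add: presented_group_def)

lemma word_inv_words: "w \<in> words S \<Longrightarrow> word_inv w \<in> words S"
  by (auto simp: words_def word_inv_def)

lemma word_inv_cancel:
  assumes "w \<in> words S"
  shows "(word_inv w @ w, []) \<in> word_cong S R"
  using assms
proof (induction w)
  case Nil
  then show ?case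
    by (simp add: word_inv_def word_cong.refl)
next
  case (Cons a w)
  obtain x b where a: "a = (x, b)"
    by (cases a)
  have w: "w \<in> words S" "x \<in> S"
    using Cons.prems a by auto
  have "([(x, \<not> b), (x, b)], []) \<in> word_cong S R"
    using word_cong.cancel[OF w(2), of "\<not> b"] by simp
  then have "(word_inv w @ [(x, \<not> b), (x, b)] @ w, word_inv w @ [] @ w) \<in> word_cong S R"
    using w by (intro word_cong.append word_cong.refl word_inv_words)
  then have "(word_inv w @ [(x, \<not> b), (x, b)] @ w, []) \<in> word_cong S R"
    using Cons.IH[OF w(1)] by (auto intro: word_cong.trans)
  then show ?case
    by (simp add: a word_inv_def)
qed

lemma group_presented_group: "group (presented_group S R)"
proof (rule groupI)
  show "\<exists>y\<in>carrier (presented_group S R). y \<otimes>\<^bsub>presented_group S R\<^esub> x = \<one>\<^bsub>presented_group S R\<^esub>"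
    if "x \<in> carrier (presented_group S R)" for x
  proof -
    obtain w where w: "w \<in> words S" "x = word_cong S R `` {w}"
      using \<open>x \<in> carrier (presented_group S R)\<close> by (auto simp: presented_group_carrier)
    have "word_cong S R `` {word_inv w @ w} = word_cong S R `` {[]}"
      using word_inv_cancel[OF w(1)] by (rule equiv_class_eq[OF equiv_word_cong])
    then show ?thesis
      using w word_inv_words
      by (intro bexI[of _ "word_cong S R `` {word_inv w}"])
        (auto simp: presented_group_carrier presented_group_mult presented_group_one)
  qed
qed (auto simp: presented_group_carrier presented_group_mult presented_group_one)

lemma presented_gen_closed: "x \<in> S \<Longrightarrow> presented_gen S R x \<in> carrier (presented_group S R)"
  by (auto simp: presented_gen_def presented_group_carrier)

text \<open>This turns relations between words into equations in the presented group. The cancelling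
  pair identifies the class of a negative letter with the inverse of its generator.\<close>

lemma word_eval_presented_gen:
  assumes "w \<in> words S"
  shows "word_eval (presented_group S R) (presented_gen S R) w = word_cong S R `` {w}"
  using assms
proof (induction w)
  case Nil
  then show ?case
    by (simp add: presented_group_one)
next
  case (Cons a w)
  interpret group "presented_group S R"
    by (rule group_presented_group)
  obtain x b where a: "a = (x, b)"
    by (cases a)
  have w: "w \<in> words S" "x \<in> S"
    using Cons.prems a by auto
  have "word_cong S R `` {[(x, False), (x, True)]} = word_cong S R `` {[]}"
    using word_cong.cancel[OF w(2), of False] by (intro equiv_class_eq[OF equiv_word_cong]) simp
  then have "word_cong S R `` {[(x, False)]} \<otimes>\<^bsub>presented_group S R\<^esub> presented_gen S R x = \<one>\<^bsub>presented_group S R\<^esub>"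
    using w(2) by (simp add: presented_gen_def presented_group_mult presented_group_one)
  then have "inv\<^bsub>presented_group S R\<^esub> presented_gen S R x = word_cong S R `` {[(x, False)]}"
    using w(2) presented_gen_closed by (intro inv_equality) (auto simp: presented_group_carrier)
  then show ?case
    using a w Cons.IH by (cases b) (simp_all add: presented_gen_def presented_group_mult)
qed

lemma presented_group_rel:
  assumes "(u, v) \<in> R" "u \<in> words S" "v \<in> words S"
  shows "word_eval (presented_group S R) (presented_gen S R) u =
    word_eval (presented_group S R) (presented_gen S R) v"
  using assms equiv_class_eq[OF equiv_word_cong word_cong.rel] by (simp add: word_eval_presented_gen)

lemma presented_group_generate: "generate (presented_group S R) (presented_gen S R ` S) = carrier (presented_group S R)"
proof -
  interpret group "presented_group S R"
    by (rule group_presented_group)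
  have sub: "subgroup (generate (presented_group S R) (presented_gen S R ` S)) (presented_group S R)"
    using presented_gen_closed by (intro generate_is_subgroup) auto
  have "word_cong S R `` {w} \<in> generate (presented_group S R) (presented_gen S R ` S)" if "w \<in> words S" for w
  proof -
    have "word_eval (presented_group S R) (presented_gen S R) w \<in> generate (presented_group S R) (presented_gen S R ` S)"
      using that by (intro word_eval_subgroup[OF sub]) (auto simp: words_def intro: generate.incl)
    then show ?thesis
      using that by (simp add: word_eval_presented_gen)
  qed
  then show ?thesis
    using subgroup.subset[OF sub] by (auto simp: presented_group_carrier)
qed

text \<open>The homomorphism evaluates a representative word; \<open>word_eval_cong\<close> makes
  the value independent of the choice.\<close>

lemma presented_group_universal:
  assumes H: "group H" and f: "f \<in> S \<rightarrow> carrier H"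
    and R: "\<And>u v. (u, v) \<in> R \<Longrightarrow> u \<in> words S \<Longrightarrow> v \<in> words S \<Longrightarrow> word_eval H f u = word_eval H f v"
  shows "\<exists>h\<in>hom (presented_group S R) H. \<forall>x\<in>S. h (presented_gen S R x) = f x"
proof -
  interpret H: group H by (rule H)
  define h where "h C = word_eval H f (SOME w. w \<in> C)" for C
  have h: "h (word_cong S R `` {w}) = word_eval H f w" if w: "w \<in> words S" for w
  proof -
    have "w \<in> word_cong S R `` {w}"
      using w by (simp add: word_cong.refl)
    then have "(w, SOME u. u \<in> word_cong S R `` {w}) \<in> word_cong S R"
      by (metis Image_singleton_iff someI)
    then show ?thesis
      unfolding h_def using H.word_eval_cong[OF f R] by metis
  qed
  have "h \<in> hom (presented_group S R) H"
    by (rule homI)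
      (auto simp: presented_group_carrier presented_group_mult h H.word_eval_append[OF f] H.word_eval_closed[OF f])
  moreover have "h (presented_gen S R x) = f x" if "x \<in> S" for x
  proof -
    have "f x \<in> carrier H"
      using f that by auto
    then show ?thesis
      using that by (simp add: presented_gen_def h)
  qed
  ultimately show ?thesis
    by blast
qed

section \<open>Application to the presented tensor products\<close>

context crossed_module
begin

abbreviation tensor_gens :: "('m, 'g) tensor_gen set" where
  "tensor_gens \<equiv> {Tens m g | m g. m \<in> carrier M \<and> g \<in> carrier G}"

definition conj_tensor_rels :: "('m, 'g) tensor_gen word rel" where
  "conj_tensor_rels = tensor_rels M \<mu> \<alpha> G id (conj_action G)"

lemma conj_action_eq [simp]: "x \<in> carrier G \<Longrightarrow> conj_action G g x = conjugate g x"
  by (simp add: conj_action_def)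

text \<open>Stated for arbitrary larger \<open>B\<close> and \<open>R\<close>, so that it serves
  both the plain product and the product modulo \<open>p\<close>.\<close>

lemma presented_tensor_mult_right:
  assumes gens: "tensor_gens \<subseteq> B" and rels: "conj_tensor_rels \<subseteq> R"
    and mem: "m \<in> carrier M" "g \<in> carrier G" "h \<in> carrier G"
  shows "presented_gen B R (Tens m (g \<otimes>\<^bsub>G\<^esub> h)) =
    presented_gen B R (Tens m g) \<otimes>\<^bsub>presented_group B R\<^esub> presented_gen B R (Tens (\<alpha> g m) (conjugate g h))"
proof -
  interpret group "presented_group B R"
    by (rule group_presented_group)
  have B: "Tens m g \<in> B" if "m \<in> carrier M" "g \<in> carrier G" for m g
    using that gens by blast
  have "(tens m (g \<otimes>\<^bsub>G\<^esub> h), tens m g @ tens (\<alpha> g m) (conjugate g h)) \<in> R"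
    using rels mem by (force simp: conj_tensor_rels_def tensor_rels_def)
  from presented_group_rel[OF this, of B] show ?thesis
    using mem by (simp add: B presented_gen_closed)
qed

lemma presented_tensor_mult_left:
  assumes gens: "tensor_gens \<subseteq> B" and rels: "conj_tensor_rels \<subseteq> R"
    and mem: "m \<in> carrier M" "m' \<in> carrier M" "g \<in> carrier G"
  shows "presented_gen B R (Tens (m \<otimes>\<^bsub>M\<^esub> m') g) =
    presented_gen B R (Tens (\<alpha> (\<mu> m) m') (conjugate (\<mu> m) g)) \<otimes>\<^bsub>presented_group B R\<^esub> presented_gen B R (Tens m g)"
proof -
  interpret group "presented_group B R"
    by (rule group_presented_group)
  have B: "Tens m g \<in> B" if "m \<in> carrier M" "g \<in> carrier G" for m g
    using that gens by blast
  have "(tens (m \<otimes>\<^bsub>M\<^esub> m') g, tens (\<alpha> (\<mu> m) m') (conjugate (\<mu> m) g) @ tens m g) \<in> R"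
    using rels mem by (force simp: conj_tensor_rels_def tensor_rels_def)
  from presented_group_rel[OF this, of B] show ?thesis
    using mem by (simp add: B presented_gen_closed)
qed

section \<open>The presented tensor product and its structure maps\<close>

definition conj_tensor :: "('m, 'g) tensor_gen word set monoid" where
  "conj_tensor = tensor_product M \<mu> \<alpha> G id (conj_action G)"

definition tensor :: "'m \<Rightarrow> 'g \<Rightarrow> ('m, 'g) tensor_gen word set" where
  "tensor m g = presented_gen tensor_gens conj_tensor_rels (Tens m g)"

lemma conj_tensor_eq: "conj_tensor = presented_group tensor_gens conj_tensor_rels"
  by (simp add: conj_tensor_def conj_tensor_rels_def tensor_product_def)

lemma conj_tensor_universal:
  assumes H: "group H" and f: "\<And>m g. m \<in> carrier M \<Longrightarrow> g \<in> carrier G \<Longrightarrow> f m g \<in> carrier H"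
    and right: "\<And>m g h. m \<in> carrier M \<Longrightarrow> g \<in> carrier G \<Longrightarrow> h \<in> carrier G \<Longrightarrow>
      f m (g \<otimes>\<^bsub>G\<^esub> h) = f m g \<otimes>\<^bsub>H\<^esub> f (\<alpha> g m) (conjugate g h)"
    and left: "\<And>m m' g. m \<in> carrier M \<Longrightarrow> m' \<in> carrier M \<Longrightarrow> g \<in> carrier G \<Longrightarrow>
      f (m \<otimes>\<^bsub>M\<^esub> m') g = f (\<alpha> (\<mu> m) m') (conjugate (\<mu> m) g) \<otimes>\<^bsub>H\<^esub> f m g"
  shows "\<exists>h\<in>hom conj_tensor H. \<forall>m\<in>carrier M. \<forall>g\<in>carrier G. h (tensor m g) = f m g"
proof -
  interpret H: group H by (rule H)
  \<comment> \<open>Braces are not generators here; the unit is a default value that makes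
    \<open>f'\<close> total.\<close>
  define f' where "f' x = (case x of Tens m g \<Rightarrow> f m g | Brace _ \<Rightarrow> \<one>\<^bsub>H\<^esub>)" for x
  have f': "f' (Tens m g) = f m g" for m g
    by (simp add: f'_def)
  have "\<exists>h\<in>hom (presented_group tensor_gens conj_tensor_rels) H.
      \<forall>x\<in>tensor_gens. h (presented_gen tensor_gens conj_tensor_rels x) = f' x"
  proof (rule presented_group_universal[OF H])
    show "f' \<in> tensor_gens \<rightarrow> carrier H"
      using f by (auto simp: f')
    fix u v assume "(u, v) \<in> conj_tensor_rels"
    then consider m g h where "m \<in> carrier M" "g \<in> carrier G" "h \<in> carrier G"
        "u = tens m (g \<otimes>\<^bsub>G\<^esub> h)" "v = tens m g @ tens (\<alpha> g m) (conjugate g h)"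
      | m m' g where "m \<in> carrier M" "m' \<in> carrier M" "g \<in> carrier G"
        "u = tens (m \<otimes>\<^bsub>M\<^esub> m') g" "v = tens (\<alpha> (\<mu> m) m') (conjugate (\<mu> m) g) @ tens m g"
      by (auto simp: conj_tensor_rels_def tensor_rels_def)
    then show "word_eval H f' u = word_eval H f' v"
    proof cases
      case 1
      then show ?thesis
        using right[of m g h] by (simp add: f f')
    next
      case 2
      then show ?thesis
        using left[of m m' g] by (simp add: f f')
    qed
  qed
  then show ?thesis
    unfolding conj_tensor_eq tensor_def f'[symmetric] by blast
qed

lemma tensor_product_props:
  shows "group conj_tensor"
    and "m \<in> carrier M \<Longrightarrow> g \<in> carrier G \<Longrightarrow> tensor m g \<in> carrier conj_tensor"
    and "generate conj_tensor {tensor m g | m g. m \<in> carrier M \<and> g \<in> carrier G} = carrier conj_tensor"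
    and "m \<in> carrier M \<Longrightarrow> g \<in> carrier G \<Longrightarrow> h \<in> carrier G \<Longrightarrow>
      tensor m (g \<otimes>\<^bsub>G\<^esub> h) = tensor m g \<otimes>\<^bsub>conj_tensor\<^esub> tensor (\<alpha> g m) (conjugate g h)"
    and "m \<in> carrier M \<Longrightarrow> m' \<in> carrier M \<Longrightarrow> g \<in> carrier G \<Longrightarrow>
      tensor (m \<otimes>\<^bsub>M\<^esub> m') g = tensor (\<alpha> (\<mu> m) m') (conjugate (\<mu> m) g) \<otimes>\<^bsub>conj_tensor\<^esub> tensor m g"
proof -
  show "group conj_tensor"
    unfolding conj_tensor_eq by (rule group_presented_group)
  show "m \<in> carrier M \<Longrightarrow> g \<in> carrier G \<Longrightarrow> tensor m g \<in> carrier conj_tensor"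
    unfolding conj_tensor_eq tensor_def by (rule presented_gen_closed) blast
  have "{tensor m g | m g. m \<in> carrier M \<and> g \<in> carrier G} = presented_gen tensor_gens conj_tensor_rels ` tensor_gens"
    by (auto simp: tensor_def)
  then show "generate conj_tensor {tensor m g | m g. m \<in> carrier M \<and> g \<in> carrier G} = carrier conj_tensor"
    unfolding conj_tensor_eq by (simp only: presented_group_generate)
  show "m \<in> carrier M \<Longrightarrow> g \<in> carrier G \<Longrightarrow> h \<in> carrier G \<Longrightarrow>
      tensor m (g \<otimes>\<^bsub>G\<^esub> h) = tensor m g \<otimes>\<^bsub>conj_tensor\<^esub> tensor (\<alpha> g m) (conjugate g h)"
    unfolding conj_tensor_eq tensor_def by (rule presented_tensor_mult_right[OF subset_refl subset_refl])
  show "m \<in> carrier M \<Longrightarrow> m' \<in> carrier M \<Longrightarrow> g \<in> carrier G \<Longrightarrow>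
      tensor (m \<otimes>\<^bsub>M\<^esub> m') g = tensor (\<alpha> (\<mu> m) m') (conjugate (\<mu> m) g) \<otimes>\<^bsub>conj_tensor\<^esub> tensor m g"
    unfolding conj_tensor_eq tensor_def by (rule presented_tensor_mult_left[OF subset_refl subset_refl])
qed

text \<open>The universal property yields \<open>lam\<close> and each \<open>act g\<close> once
  their prescribed values on tensors are seen to respect the two relations.\<close>

lemma crossed_tensor_exists:
  "\<exists>lam act. crossed_tensor M G \<mu> \<alpha> conj_tensor tensor lam act"
proof -
  note props = tensor_product_props
  have lam: "\<exists>lam\<in>hom conj_tensor M. \<forall>m\<in>carrier M. \<forall>g\<in>carrier G. lam (tensor m g) = m \<otimes>\<^bsub>M\<^esub> \<alpha> g (inv\<^bsub>M\<^esub> m)"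
  proof (rule conj_tensor_universal)
    fix m g h assume mem: "m \<in> carrier M" "g \<in> carrier G" "h \<in> carrier G"
    \<comment> \<open>The conjugate of \<open>h\<close> by \<open>g\<close>, multiplied by
      \<open>g\<close>, is \<open>g h\<close>; in the product to be checked,
      \<open>\<alpha> g m\<close> then cancels against its inverse.\<close>
    have "\<alpha> (conjugate g h) (inv\<^bsub>M\<^esub> \<alpha> g m) = \<alpha> (conjugate g h \<otimes>\<^bsub>G\<^esub> g) (inv\<^bsub>M\<^esub> m)"
      using mem by (simp add: action_comp flip: action_inv)
    also have "conjugate g h \<otimes>\<^bsub>G\<^esub> g = g \<otimes>\<^bsub>G\<^esub> h"
      using mem by (simp add: G.m_assoc)
    finally show "m \<otimes>\<^bsub>M\<^esub> \<alpha> (g \<otimes>\<^bsub>G\<^esub> h) (inv\<^bsub>M\<^esub> m) =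
        m \<otimes>\<^bsub>M\<^esub> \<alpha> g (inv\<^bsub>M\<^esub> m) \<otimes>\<^bsub>M\<^esub> (\<alpha> g m \<otimes>\<^bsub>M\<^esub> \<alpha> (conjugate g h) (inv\<^bsub>M\<^esub> \<alpha> g m))"
      using mem by (simp add: action_inv[of g m] M.m_assoc)
  next
    fix m m' g assume mem: "m \<in> carrier M" "m' \<in> carrier M" "g \<in> carrier G"
    have "\<alpha> (conjugate (\<mu> m) g) (inv\<^bsub>M\<^esub> \<alpha> (\<mu> m) m') = \<alpha> (conjugate (\<mu> m) g \<otimes>\<^bsub>G\<^esub> \<mu> m) (inv\<^bsub>M\<^esub> m')"
      using mem by (simp add: action_comp flip: action_inv)
    also have "conjugate (\<mu> m) g \<otimes>\<^bsub>G\<^esub> \<mu> m = \<mu> m \<otimes>\<^bsub>G\<^esub> g"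
      using mem by (simp add: G.m_assoc)
    also have "\<alpha> (\<mu> m \<otimes>\<^bsub>G\<^esub> g) (inv\<^bsub>M\<^esub> m') = m \<otimes>\<^bsub>M\<^esub> \<alpha> g (inv\<^bsub>M\<^esub> m') \<otimes>\<^bsub>M\<^esub> inv\<^bsub>M\<^esub> m"
      using mem by (simp add: action_comp peiffer)
    finally show "m \<otimes>\<^bsub>M\<^esub> m' \<otimes>\<^bsub>M\<^esub> \<alpha> g (inv\<^bsub>M\<^esub> (m \<otimes>\<^bsub>M\<^esub> m')) =
        \<alpha> (\<mu> m) m' \<otimes>\<^bsub>M\<^esub> \<alpha> (conjugate (\<mu> m) g) (inv\<^bsub>M\<^esub> \<alpha> (\<mu> m) m') \<otimes>\<^bsub>M\<^esub> (m \<otimes>\<^bsub>M\<^esub> \<alpha> g (inv\<^bsub>M\<^esub> m))"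
      using mem by (simp add: peiffer action_mult M.m_assoc M.inv_mult_group)
  qed (use M.is_group in auto)
  have "\<exists>h\<in>hom conj_tensor conj_tensor. \<forall>m\<in>carrier M. \<forall>k\<in>carrier G. h (tensor m k) = tensor (\<alpha> g m) (conjugate g k)"
    if g: "g \<in> carrier G" for g
  proof (rule conj_tensor_universal)
    fix m h k assume mem: "m \<in> carrier M" "h \<in> carrier G" "k \<in> carrier G"
    have "tensor (\<alpha> g m) (conjugate g (h \<otimes>\<^bsub>G\<^esub> k)) = tensor (\<alpha> g m) (conjugate g h \<otimes>\<^bsub>G\<^esub> conjugate g k)"
      using g mem by (simp add: G.m_assoc)
    also have "\<dots> = tensor (\<alpha> g m) (conjugate g h) \<otimes>\<^bsub>conj_tensor\<^esub>
        tensor (\<alpha> (conjugate g h) (\<alpha> g m)) (conjugate (conjugate g h) (conjugate g k))"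
      using g mem by (intro props) auto
    also have "\<alpha> (conjugate g h) (\<alpha> g m) = \<alpha> g (\<alpha> h m)"
      using g mem by (simp add: G.m_assoc flip: action_comp)
    also have "conjugate (conjugate g h) (conjugate g k) = conjugate g (conjugate h k)"
      using g mem by (simp add: G.m_assoc G.inv_mult_group)
    finally show "tensor (\<alpha> g m) (conjugate g (h \<otimes>\<^bsub>G\<^esub> k)) = tensor (\<alpha> g m) (conjugate g h) \<otimes>\<^bsub>conj_tensor\<^esub>
        tensor (\<alpha> g (\<alpha> h m)) (conjugate g (conjugate h k))" .
  next
    fix m m' k assume mem: "m \<in> carrier M" "m' \<in> carrier M" "k \<in> carrier G"
    have "tensor (\<alpha> g (m \<otimes>\<^bsub>M\<^esub> m')) (conjugate g k) =
        tensor (\<alpha> (\<mu> (\<alpha> g m)) (\<alpha> g m')) (conjugate (\<mu> (\<alpha> g m)) (conjugate g k)) \<otimes>\<^bsub>conj_tensor\<^esub>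
        tensor (\<alpha> g m) (conjugate g k)"
      using g mem props(5)[of "\<alpha> g m" "\<alpha> g m'" "conjugate g k"] by (simp add: action_mult)
    also have "\<alpha> (\<mu> (\<alpha> g m)) (\<alpha> g m') = \<alpha> g (\<alpha> (\<mu> m) m')"
      using g mem by (simp add: peiffer action_mult action_inv)
    also have "conjugate (\<mu> (\<alpha> g m)) (conjugate g k) = conjugate g (conjugate (\<mu> m) k)"
      using g mem by (simp add: equivariant G.m_assoc G.inv_mult_group)
    finally show "tensor (\<alpha> g (m \<otimes>\<^bsub>M\<^esub> m')) (conjugate g k) =
        tensor (\<alpha> g (\<alpha> (\<mu> m) m')) (conjugate g (conjugate (\<mu> m) k)) \<otimes>\<^bsub>conj_tensor\<^esub>
        tensor (\<alpha> g m) (conjugate g k)" .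
  qed (use g props(1,2) in auto)
  then obtain act where act: "act g \<in> hom conj_tensor conj_tensor"
      "m \<in> carrier M \<Longrightarrow> k \<in> carrier G \<Longrightarrow> act g (tensor m k) = tensor (\<alpha> g m) (conjugate g k)"
    if "g \<in> carrier G" for g m k
    by metis
  obtain lam where lam: "lam \<in> hom conj_tensor M"
      "m \<in> carrier M \<Longrightarrow> g \<in> carrier G \<Longrightarrow> lam (tensor m g) = m \<otimes>\<^bsub>M\<^esub> \<alpha> g (inv\<^bsub>M\<^esub> m)" for m g
    using lam by blast
  have "crossed_tensor M G \<mu> \<alpha> conj_tensor tensor lam act"
  proof (intro crossed_tensor.intro crossed_tensor_axioms.intro crossed_module_axioms)
    fix m g h assume mem: "m \<in> carrier M" "g \<in> carrier G" "h \<in> carrier G"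
    show "tensor m (g \<otimes>\<^bsub>G\<^esub> h) = tensor m g \<otimes>\<^bsub>conj_tensor\<^esub> act g (tensor m h)"
      using mem props(4)[of m g h] act(2)[of g m h] by simp
  next
    fix m m' g assume mem: "m \<in> carrier M" "m' \<in> carrier M" "g \<in> carrier G"
    show "tensor (m \<otimes>\<^bsub>M\<^esub> m') g = act (\<mu> m) (tensor m' g) \<otimes>\<^bsub>conj_tensor\<^esub> tensor m g"
      using mem props(5)[of m m' g] act(2)[of "\<mu> m" m' g] by simp
  qed (simp_all add: props(1-3) lam act)
  then show ?thesis
    by blast
qed

section \<open>Brace indices and the product modulo p\<close>

text \<open>With the identity as second map, the fibre product is the graph of \<open>\<mu>\<close>,
  a copy of \<open>M\<close>.\<close>

definition graph_product :: "('m \<times> 'g) monoid" where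
  "graph_product = fibre_product M G \<mu> id"

lemma graph_product_simps:
  "k \<in> carrier graph_product \<longleftrightarrow> (\<exists>m\<in>carrier M. k = (m, \<mu> m))"
  "(m, g) \<otimes>\<^bsub>graph_product\<^esub> (m', g') = (m \<otimes>\<^bsub>M\<^esub> m', g \<otimes>\<^bsub>G\<^esub> g')"
  "\<one>\<^bsub>graph_product\<^esub> = (\<one>\<^bsub>M\<^esub>, \<one>\<^bsub>G\<^esub>)"
  by (auto simp: graph_product_def fibre_product_def DirProd_def)

lemma graph_product_pow:
  "(m, g) [^]\<^bsub>graph_product\<^esub> (n :: nat) = (m [^]\<^bsub>M\<^esub> n, g [^]\<^bsub>G\<^esub> n)"
  by (induction n) (simp_all add: graph_product_simps)

lemma group_graph_product: "group graph_product"
proof (rule groupI)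
  show "\<exists>y\<in>carrier graph_product. y \<otimes>\<^bsub>graph_product\<^esub> x = \<one>\<^bsub>graph_product\<^esub>"
    if "x \<in> carrier graph_product" for x
  proof -
    obtain m where "m \<in> carrier M" "x = (m, \<mu> m)"
      using \<open>x \<in> carrier graph_product\<close> by (auto simp: graph_product_simps)
    then show ?thesis
      by (intro bexI[of _ "(inv\<^bsub>M\<^esub> m, \<mu> (inv\<^bsub>M\<^esub> m))"]) (auto simp: graph_product_simps)
  qed
qed (auto simp: graph_product_simps M.m_assoc G.m_assoc)

lemma graph_product_closed: "k \<in> carrier graph_product \<Longrightarrow> fst k \<in> carrier M \<and> snd k \<in> carrier G"
  by (auto simp: graph_product_simps)

theorem powerful_tensor_products:
  assumes p: "Factorial_Ring.prime (p::nat)" "odd p" and powerful: "powerful p M" "powerfully_embedded p (\<mu> ` carrier M) G"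
  shows "powerful p (tensor_product M \<mu> \<alpha> G id (conj_action G))"
    and "powerful p (tensor_product_mod p M \<mu> \<alpha> G id (conj_action G))"
proof -
  obtain lam act where "crossed_tensor M G \<mu> \<alpha> conj_tensor tensor lam act"
    using crossed_tensor_exists by blast
  then interpret crossed_tensor M G \<mu> \<alpha> conj_tensor tensor lam act .
  interpret powerful_crossed_tensor M G \<mu> \<alpha> conj_tensor tensor lam act p
    by unfold_locales (fact p powerful)+
  show "powerful p (tensor_product M \<mu> \<alpha> G id (conj_action G))"
    unfolding conj_tensor_def[symmetric] by (rule powerful_tensor)
  define B where "B = tensor_gens \<union> {Brace k | k. k \<in> carrier graph_product}"
  define R where "R = conj_tensor_rels \<union> tensor_mod_rels p M \<mu> \<alpha> G id (conj_action G)"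
  define S where "S = presented_group B R"
  define \<sigma> where "\<sigma> m g = presented_gen B R (Tens m g)" for m g
  define br where "br k = presented_gen B R (Brace (k, \<mu> k))" for k
  interpret S: group S
    unfolding S_def by (rule group_presented_group)
  interpret K: group graph_product
    by (rule group_graph_product)
  have B: "Tens m g \<in> B \<longleftrightarrow> m \<in> carrier M \<and> g \<in> carrier G" "Brace k \<in> B \<longleftrightarrow> (\<exists>m\<in>carrier M. k = (m, \<mu> m))" for m g k
    by (auto simp: B_def graph_product_simps)
  have \<sigma>_closed: "\<sigma> m g \<in> carrier S" if "m \<in> carrier M" "g \<in> carrier G" for m g
    unfolding \<sigma>_def S_def using that B by (intro presented_gen_closed) auto
  have br_closed: "br k \<in> carrier S" if "k \<in> carrier M" for k
    unfolding br_def S_def using that B by (intro presented_gen_closed) auto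
  have eval: "word_eval S (presented_gen B R) u = word_eval S (presented_gen B R) v"
    if "(u, v) \<in> R" "u \<in> words B" "v \<in> words B" for u v
    unfolding S_def using that by (rule presented_group_rel)
  have sub: "tensor_gens \<subseteq> B" "conj_tensor_rels \<subseteq> R"
    by (auto simp: B_def R_def)
  \<comment> \<open>The tensor relations also hold in \<open>S\<close>, so the universal property
    gives the map from the plain tensor product.\<close>
  have "\<exists>\<iota>\<in>hom conj_tensor S. \<forall>m\<in>carrier M. \<forall>g\<in>carrier G. \<iota> (tensor m g) = \<sigma> m g"
    by (rule conj_tensor_universal[OF S.is_group \<sigma>_closed]; (assumption | (unfold \<sigma>_def S_def,
          rule presented_tensor_mult_right[OF sub] presented_tensor_mult_left[OF sub]; assumption)))
  then obtain \<iota> where \<iota>: "\<iota> \<in> hom conj_tensor S"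
    "\<And>m g. m \<in> carrier M \<Longrightarrow> g \<in> carrier G \<Longrightarrow> \<iota> (tensor m g) = \<sigma> m g"
    by blast
  interpret \<iota>: group_hom conj_tensor S \<iota>
    by (intro group_hom.intro group_hom_axioms.intro T.is_group S.is_group \<iota>)
  have S_eq: "tensor_product_mod p M \<mu> \<alpha> G id (conj_action G) = S"
    by (simp add: tensor_product_mod_def S_def B_def R_def graph_product_def conj_tensor_rels_def)
  have "powerful_crossed_tensor_mod M G \<mu> \<alpha> conj_tensor tensor lam act p S \<iota> br"
  proof (intro powerful_crossed_tensor_mod.intro powerful_crossed_tensor_mod_axioms.intro
      powerful_crossed_tensor_axioms S.is_group \<iota>(1) br_closed)
    have "presented_gen B R ` B \<subseteq> \<iota> ` carrier conj_tensor \<union> br ` carrier M"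
    proof
      fix y assume "y \<in> presented_gen B R ` B"
      then consider m g where "m \<in> carrier M" "g \<in> carrier G" "y = \<sigma> m g"
        | k where "k \<in> carrier M" "y = br k"
        by (auto simp: B_def graph_product_simps \<sigma>_def br_def)
      then show "y \<in> \<iota> ` carrier conj_tensor \<union> br ` carrier M"
        by cases (auto simp flip: \<iota>(2))
    qed
    then have "generate S (presented_gen B R ` B) \<subseteq> generate S (\<iota> ` carrier conj_tensor \<union> br ` carrier M)"
      by (rule S.mono_generate)
    then have "carrier S \<subseteq> generate S (\<iota> ` carrier conj_tensor \<union> br ` carrier M)"
      by (simp add: S_def presented_group_generate)
    moreover have "\<iota> ` carrier conj_tensor \<union> br ` carrier M \<subseteq> carrier S"
      using br_closed by auto
    ultimately show "generate S (\<iota> ` carrier conj_tensor \<union> br ` carrier M) = carrier S"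
      using S.generate_incl by blast
  next
    fix k m g assume mem: "k \<in> carrier M" "m \<in> carrier M" "g \<in> carrier G"
    let ?h = "\<mu> (k [^]\<^bsub>M\<^esub> p)"
    let ?k = "(k, \<mu> k)"
    have k: "?k \<in> carrier graph_product"
      using mem by (auto simp: graph_product_simps)
    \<comment> \<open>The conjugation relation; powers in the graph are computed entrywise.\<close>
    have "(brace ?k @ tens m g @ word_inv (brace ?k), tens (\<alpha> (\<mu> (fst (?k [^]\<^bsub>graph_product\<^esub> p))) m)
        (conj_action G (\<mu> (fst (?k [^]\<^bsub>graph_product\<^esub> p))) g)) \<in> R"
      unfolding R_def tensor_mod_rels_def Let_def graph_product_def[symmetric] using k mem by blast
    from eval[OF this] show "br k \<otimes>\<^bsub>S\<^esub> \<iota> (tensor m g) \<otimes>\<^bsub>S\<^esub> inv\<^bsub>S\<^esub> br k = \<iota> (act ?h (tensor m g))"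
      using mem \<sigma>_closed br_closed
      by (simp add: word_inv_def B graph_product_pow act_tensor \<iota>(2) S.m_assoc flip: \<sigma>_def br_def)
  next
    fix k k' assume mem: "k \<in> carrier M" "k' \<in> carrier M"
    let ?k = "(k, \<mu> k)" and ?k' = "(k', \<mu> k')"
    define w where "w = concat (map (\<lambda>i. tens (fst (inv\<^bsub>graph_product\<^esub> ?k))
      (conj_action G (\<mu> (fst (?k [^]\<^bsub>graph_product\<^esub> (1 - int p + int i)))) (snd ?k') [^]\<^bsub>G\<^esub> i)) [1..<p])"
    have k: "?k \<in> carrier graph_product" "?k' \<in> carrier graph_product"
      using mem by (auto simp: graph_product_simps)
    have rel: "(brace (?k \<otimes>\<^bsub>graph_product\<^esub> ?k'), brace ?k @ w @ brace ?k') \<in> R"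
      unfolding R_def tensor_mod_rels_def Let_def graph_product_def[symmetric] w_def using k by blast
    \<comment> \<open>Inverses and integer powers stay in the graph, so the negative exponents
      \<open>1 - p + i\<close> also give genuine tensor letters, and \<open>w\<close> evaluates into
      the image of the plain tensor product.\<close>
    have letters: "(x, b) \<in> set w \<Longrightarrow> \<exists>m\<in>carrier M. \<exists>g\<in>carrier G. x = Tens m g" for x b
      using mem graph_product_closed[OF K.inv_closed[OF k(1)]] graph_product_closed[OF K.int_pow_closed[OF k(1)]]
      by (auto simp: w_def)
    have w: "w \<in> words B"
    proof -
      have "a \<in> B \<times> UNIV" if "a \<in> set w" for a
      proof -
        obtain x b where "a = (x, b)"
          by (cases a)
        then show ?thesis
          using that letters[of x b] B(1) by blast
      qed
      then show ?thesis
        unfolding words_def in_lists_conv_set by blast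
    qed
    have "word_eval S (presented_gen B R) w \<in> \<iota> ` carrier conj_tensor"
    proof (rule S.word_eval_subgroup[OF \<iota>.img_is_subgroup])
      fix x b assume "(x, b) \<in> set w"
      then obtain m g where "m \<in> carrier M" "g \<in> carrier G" "x = Tens m g"
        using letters by blast
      then show "presented_gen B R x \<in> \<iota> ` carrier conj_tensor"
        by (auto simp flip: \<iota>(2) \<sigma>_def)
    qed
    then obtain t where t: "t \<in> carrier conj_tensor" "word_eval S (presented_gen B R) w = \<iota> t"
      by blast
    have gens: "presented_gen B R \<in> B \<rightarrow> carrier S"
      using presented_gen_closed by (auto simp: S_def)
    have "word_eval S (presented_gen B R) (brace ?k @ w @ brace ?k') =
        br k \<otimes>\<^bsub>S\<^esub> \<iota> t \<otimes>\<^bsub>S\<^esub> br k'"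
      using mem w t br_closed S.word_eval_append[OF gens w, of "brace ?k'"]
      by (simp add: B S.m_assoc flip: br_def)
    moreover have "word_eval S (presented_gen B R) (brace (?k \<otimes>\<^bsub>graph_product\<^esub> ?k')) = br (k \<otimes>\<^bsub>M\<^esub> k')"
      using mem br_closed[of "k \<otimes>\<^bsub>M\<^esub> k'"] by (simp add: graph_product_simps br_def)
    ultimately have "br (k \<otimes>\<^bsub>M\<^esub> k') = br k \<otimes>\<^bsub>S\<^esub> \<iota> t \<otimes>\<^bsub>S\<^esub> br k'"
      using eval[OF rel] mem w by (simp add: B graph_product_simps)
    then show "\<exists>t\<in>carrier conj_tensor. br (k \<otimes>\<^bsub>M\<^esub> k') = br k \<otimes>\<^bsub>S\<^esub> \<iota> t \<otimes>\<^bsub>S\<^esub> br k'"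
      using t(1) by blast
  next
    fix k k' assume mem: "k \<in> carrier M" "k' \<in> carrier M"
    let ?k = "(k, \<mu> k)" and ?k' = "(k', \<mu> k')"
    have k: "?k \<in> carrier graph_product" "?k' \<in> carrier graph_product"
      using mem by (auto simp: graph_product_simps)
    \<comment> \<open>The commutator relation; since \<open>\<mu>\<close> is a homomorphism, the
      second entry of the p-th power of \<open>?k'\<close> is the boundary of the p-th power of
      \<open>k'\<close>.\<close>
    have "(brace ?k @ brace ?k' @ word_inv (brace ?k) @ word_inv (brace ?k'),
        tens (fst (?k [^]\<^bsub>graph_product\<^esub> p)) (snd (?k' [^]\<^bsub>graph_product\<^esub> p))) \<in> R"
      unfolding R_def tensor_mod_rels_def Let_def graph_product_def[symmetric] using k by blast
    from eval[OF this] show "br k \<otimes>\<^bsub>S\<^esub> br k' \<otimes>\<^bsub>S\<^esub> inv\<^bsub>S\<^esub> br k \<otimes>\<^bsub>S\<^esub> inv\<^bsub>S\<^esub> br k' =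
        \<iota> (tensor (k [^]\<^bsub>M\<^esub> p) (\<mu> (k' [^]\<^bsub>M\<^esub> p)))"
      using mem \<sigma>_closed br_closed
      by (simp add: word_inv_def B graph_product_pow boundary.hom_nat_pow \<iota>(2) S.m_assoc flip: \<sigma>_def br_def)
  qed
  then show "powerful p (tensor_product_mod p M \<mu> \<alpha> G id (conj_action G))"
    unfolding S_eq by (rule powerful_crossed_tensor_mod.powerful_mod)
qed

end

theorem theoremC:
  fixes M :: "('m, 'a) monoid_scheme" and G :: "('g, 'b) monoid_scheme"
    and \<mu> :: "'m \<Rightarrow> 'g" and \<alpha> :: "'g \<Rightarrow> 'm \<Rightarrow> 'm" and p :: nat
  assumes "Factorial_Ring.prime p" and "odd p"
    and "finite_p_group p M" and "finite_p_group p G"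
    and "crossed_module M G \<mu> \<alpha>"
    and "powerful p M"
    and "powerfully_embedded p (\<mu> ` carrier M) G"
  shows "powerful p (tensor_product M \<mu> \<alpha> G id (conj_action G)) \<and>
         powerful p (tensor_product_mod p M \<mu> \<alpha> G id (conj_action G))"
  using crossed_module.powerful_tensor_products[OF assms(5,1,2,6,7)] by blast

end
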